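(* Let $V$ be a bounded operator on $\ell^2(\mathbb{Z})$ for which there exists $\delta>0$ such that $\sup_{(n,m)\in\mathbb{Z}^2}e^{\delta(|n|+|m|)}|V(n,m)|<\infty$, and let $H_V=H_0+V$. Then $\sigma_{\mathrm{disc}}(H_V)$ has no limit points in $[0,4]$, hence is finite. There exists also a finite subset $\mathcal{D}'\subset(0,4)$ for which the following holds: given any relatively compact interval $\Delta_0$ with $\overline{\Delta_0}\subset(0,4)\setminus\mathcal{D}'$, there exists $\delta_0>0$ such that for any vectors $\varphi$ and $\psi$ in $\ell^2_\delta(\mathbb{Z})$, $$\sup_{z\in\Delta_0+i(-\delta_0,0)}|\langle\varphi,(z-H_V)^{-1}\psi\rangle|<\infty,\qquad \sup_{z\in\Delta_0+i(0,\delta_0)}|\langle\varphi,(z-H_V)^{-1}\psi\rangle|<\infty.$$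
   Context: $H_0$ is the bounded selfadjoint operator on $\ell^2(\mathbb{Z})$ given by $(H_0x)(n)=2x(n)-x(n+1)-x(n-1)$; its spectrum is $[0,4]$. For bounded $V$, $H_V:=H_0+V$ and $V(n,m)$ denotes the matrix of $V$ in the canonical orthonormal basis of $\ell^2(\mathbb{Z})$. $\ell^2_{\delta}(\mathbb{Z})=\{x\in\mathbb{C}^{\mathbb{Z}}:\sum_n e^{\delta|n|}|x(n)|^2<\infty\}\subset\ell^2(\mathbb{Z})$. $\sigma_{\mathrm{disc}}(L)$ denotes the set of isolated points $z$ of $\sigma(L)$ with finite algebraic multiplicity, i.e. whose Riesz projection has finite rank. For $\Delta_1,\Delta_2\subset\mathbb{R}$, $\Delta_1+i\Delta_2=\{z\in\mathbb{C}:\operatorname{Re}z\in\Delta_1,\ \operatorname{Im}z\in\Delta_2\}$. *)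

theory Defs
  imports "HOL-Complex_Analysis.Complex_Analysis"
begin

section \<open>The Hilbert space of square-summable two-sided complex sequences\<close>

typedef ell2 = "{x :: int \<Rightarrow> complex. (\<lambda>n. (cmod (x n))\<^sup>2) summable_on UNIV}"
  morphisms coord Abs_ell2
  by (rule exI[of _ "\<lambda>_. 0"]) simp

setup_lifting type_definition_ell2

lemma ell2_eqI: "(\<And>n. coord x n = coord y n) \<Longrightarrow> x = y"
  by (metis coord_inject ext)

lemma square_summable_coord: "(\<lambda>n. (cmod (coord x n))\<^sup>2) summable_on UNIV"
  using coord[of x] by simp

lemma square_summable_add:
  fixes x y :: "int \<Rightarrow> complex"
  assumes "(\<lambda>n. (cmod (x n))\<^sup>2) summable_on UNIV" "(\<lambda>n. (cmod (y n))\<^sup>2) summable_on UNIV"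
  shows "(\<lambda>n. (cmod (x n + y n))\<^sup>2) summable_on UNIV"
proof (rule summable_on_comparison_test)
  show "(\<lambda>n. 2 * (cmod (x n))\<^sup>2 + 2 * (cmod (y n))\<^sup>2) summable_on UNIV"
    by (intro summable_on_add summable_on_cmult_right assms)
next
  fix n
  have "(cmod (x n + y n))\<^sup>2 \<le> (cmod (x n) + cmod (y n))\<^sup>2"
    by (intro power_mono norm_triangle_ineq) auto
  also have "\<dots> \<le> 2 * (cmod (x n))\<^sup>2 + 2 * (cmod (y n))\<^sup>2"
    using sum_squares_bound[of "cmod (x n)" "cmod (y n)"] by (simp add: power2_sum)
  finally show "(cmod (x n + y n))\<^sup>2 \<le> 2 * (cmod (x n))\<^sup>2 + 2 * (cmod (y n))\<^sup>2" .
qed auto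

lemma square_summable_mult:
  fixes x :: "int \<Rightarrow> complex"
  assumes "(\<lambda>n. (cmod (x n))\<^sup>2) summable_on UNIV"
  shows "(\<lambda>n. (cmod (c * x n))\<^sup>2) summable_on UNIV"
  using summable_on_cmult_right[OF assms, of "(cmod c)\<^sup>2"]
  by (simp add: norm_mult power_mult_distrib)

lemma square_summable_shift:
  fixes x :: "int \<Rightarrow> complex"
  assumes "(\<lambda>n. (cmod (x n))\<^sup>2) summable_on UNIV"
  shows "(\<lambda>n. (cmod (x (n + k)))\<^sup>2) summable_on UNIV"
proof -
  have "bij_betw (\<lambda>n::int. n + k) UNIV UNIV"
    by (rule bij_betwI[where g = "\<lambda>n. n - k"]) auto
  from summable_on_reindex_bij_betw[OF this, of "\<lambda>n. (cmod (x n))\<^sup>2"] assms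
  show ?thesis by simp
qed

lift_definition cscale :: "complex \<Rightarrow> ell2 \<Rightarrow> ell2" (infixr \<open>*\<^sub>C\<close> 75)
  is "\<lambda>c x n. c * x n"
  by (rule square_summable_mult)

lift_definition basis_vec :: "int \<Rightarrow> ell2" is "\<lambda>m n. if n = m then 1 else 0"
proof -
  fix m :: int
  have "(\<lambda>n. (cmod (if n = m then 1 else 0))\<^sup>2) summable_on {m}"
    by simp
  then show "(\<lambda>n. (cmod (if n = m then 1 else 0))\<^sup>2) summable_on UNIV"
    by (rule summable_on_cong_neutral[THEN iffD1, rotated -1]) auto
qed

definition cinner :: "ell2 \<Rightarrow> ell2 \<Rightarrow> complex" where
  "cinner x y = (\<Sum>\<^sub>\<infinity>n. cnj (coord x n) * coord y n)"

lemma cinner_summable: "(\<lambda>n. cnj (coord x n) * coord y n) summable_on UNIV"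
proof (rule abs_summable_summable, rule summable_on_comparison_test)
  show "(\<lambda>n. (cmod (coord x n))\<^sup>2 + (cmod (coord y n))\<^sup>2) summable_on UNIV"
    by (intro summable_on_add square_summable_coord)
next
  fix n
  have "cmod (coord x n) * cmod (coord y n) \<le> 2 * cmod (coord x n) * cmod (coord y n)"
    by simp
  also have "\<dots> \<le> (cmod (coord x n))\<^sup>2 + (cmod (coord y n))\<^sup>2"
    by (rule sum_squares_bound)
  finally show "norm (cnj (coord x n) * coord y n) \<le> (cmod (coord x n))\<^sup>2 + (cmod (coord y n))\<^sup>2"
    by (simp add: norm_mult)
qed auto

instantiation ell2 :: real_vector
begin

lift_definition zero_ell2 :: ell2 is "\<lambda>_. 0" by simp

lift_definition plus_ell2 :: "ell2 \<Rightarrow> ell2 \<Rightarrow> ell2" is "\<lambda>x y n. x n + y n"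
  by (rule square_summable_add)

lift_definition uminus_ell2 :: "ell2 \<Rightarrow> ell2" is "\<lambda>x n. - x n"
  by simp

definition minus_ell2 :: "ell2 \<Rightarrow> ell2 \<Rightarrow> ell2" where "minus_ell2 x y = x + (- y)"

definition scaleR_ell2 :: "real \<Rightarrow> ell2 \<Rightarrow> ell2" where "scaleR_ell2 r x = of_real r *\<^sub>C x"

lemma coord_zero [simp]: "coord 0 n = 0"
  by (simp add: zero_ell2.rep_eq)

lemma coord_add [simp]: "coord (x + y) n = coord x n + coord y n"
  by (simp add: plus_ell2.rep_eq)

lemma coord_uminus [simp]: "coord (- x) n = - coord x n"
  by (simp add: uminus_ell2.rep_eq)

lemma coord_cscale [simp]: "coord (c *\<^sub>C x) n = c * coord x n"
  by (simp add: cscale.rep_eq)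

lemma coord_diff [simp]: "coord (x - y) n = coord x n - coord y n"
  by (simp add: minus_ell2_def)

lemma coord_scaleR [simp]: "coord (r *\<^sub>R x) n = of_real r * coord x n"
  by (simp add: scaleR_ell2_def)

instance
  by standard (rule ell2_eqI; simp add: algebra_simps)+

end

lemma coord_basis_vec [simp]: "coord (basis_vec m) n = (if n = m then 1 else 0)"
  by (simp add: basis_vec.rep_eq)

lemma cinner_self: "cinner x x = of_real (\<Sum>\<^sub>\<infinity>n. (cmod (coord x n))\<^sup>2)"
proof -
  have "cinner x x = (\<Sum>\<^sub>\<infinity>n. of_real ((cmod (coord x n))\<^sup>2))"
    unfolding cinner_def
    by (metis (no_types) complex_norm_square mult.commute)
  also have "\<dots> = of_real (\<Sum>\<^sub>\<infinity>n. (cmod (coord x n))\<^sup>2)"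
    by (rule has_sum_of_real[THEN infsumI], rule has_sum_infsum, rule square_summable_coord)
  finally show ?thesis .
qed

instantiation ell2 :: real_inner
begin

definition inner_ell2 :: "ell2 \<Rightarrow> ell2 \<Rightarrow> real" where "inner_ell2 x y = Re (cinner x y)"
definition norm_ell2 :: "ell2 \<Rightarrow> real" where "norm_ell2 x = sqrt (\<Sum>\<^sub>\<infinity>n. (cmod (coord x n))\<^sup>2)"
definition sgn_ell2 :: "ell2 \<Rightarrow> ell2" where "sgn_ell2 x = x /\<^sub>R norm x"
definition dist_ell2 :: "ell2 \<Rightarrow> ell2 \<Rightarrow> real" where "dist_ell2 x y = norm (x - y)"
definition uniformity_ell2 :: "(ell2 \<times> ell2) filter" where
  "uniformity_ell2 = (INF e\<in>{0<..}. principal {(x, y). dist x y < e})"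
definition open_ell2 :: "ell2 set \<Rightarrow> bool" where
  "open_ell2 U \<longleftrightarrow> (\<forall>x\<in>U. \<forall>\<^sub>F (x', y) in uniformity. x' = x \<longrightarrow> y \<in> U)"

instance
proof
  fix x y z :: ell2 and r :: real and U :: "ell2 set"
  have "cinner x y = cnj (cinner y x)"
    by (simp add: cinner_def mult.commute flip: infsum_cnj)
  then show "inner x y = inner y x"
    by (simp add: inner_ell2_def)
  show "inner (x + y) z = inner x z + inner y z"
    by (simp add: inner_ell2_def cinner_def distrib_right infsum_add cinner_summable)
  show "inner (r *\<^sub>R x) y = r * inner x y"
    by (simp add: inner_ell2_def cinner_def mult.assoc infsum_cmult_right')
  show "0 \<le> inner x x"
    by (simp add: inner_ell2_def cinner_self infsum_nonneg)
  show "inner x x = 0 \<longleftrightarrow> x = 0"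
  proof
    assume "inner x x = 0"
    then have "(\<Sum>\<^sub>\<infinity>n. (cmod (coord x n))\<^sup>2) \<le> 0"
      by (simp add: inner_ell2_def cinner_self)
    then have "(cmod (coord x n))\<^sup>2 = 0" for n
      by (rule nonneg_infsum_le_0D[where A = UNIV]) (auto intro: square_summable_coord)
    then show "x = 0" by (auto intro: ell2_eqI)
  qed (simp add: inner_ell2_def cinner_def)
  show "norm x = sqrt (inner x x)"
    by (simp add: norm_ell2_def inner_ell2_def cinner_self)
qed (simp_all only: sgn_ell2_def dist_ell2_def uniformity_ell2_def open_ell2_def)

end

lemma norm_ell2_square: "(norm x)\<^sup>2 = (\<Sum>\<^sub>\<infinity>n. (cmod (coord x n))\<^sup>2)"
  by (simp add: norm_ell2_def infsum_nonneg)

lemma norm_coord_le: "cmod (coord x n) \<le> norm x"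
proof -
  have "sum (\<lambda>n. (cmod (coord x n))\<^sup>2) {n} \<le> (\<Sum>\<^sub>\<infinity>n. (cmod (coord x n))\<^sup>2)"
    by (rule finite_sum_le_infsum) (auto intro: square_summable_coord)
  then have "(cmod (coord x n))\<^sup>2 \<le> (norm x)\<^sup>2" by (simp add: norm_ell2_square)
  then show ?thesis by (rule power2_le_imp_le) simp
qed

instance ell2 :: banach
proof
  fix X :: "nat \<Rightarrow> ell2"
  assume C: "Cauchy X"
  have "Cauchy (\<lambda>k. coord (X k) n)" for n
  proof (rule metric_CauchyI)
    fix e :: real assume "e > 0"
    then obtain M where M: "\<And>j k. j \<ge> M \<Longrightarrow> k \<ge> M \<Longrightarrow> dist (X j) (X k) < e"
      using C unfolding Cauchy_def by meson
    have "dist (coord (X j) n) (coord (X k) n) \<le> dist (X j) (X k)" for j k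
      using norm_coord_le[of "X j - X k" n] by (simp add: dist_norm)
    then show "\<exists>M. \<forall>j\<ge>M. \<forall>k\<ge>M. dist (coord (X j) n) (coord (X k) n) < e"
      using M le_less_trans by blast
  qed
  then have "\<exists>l. \<forall>n. (\<lambda>k. coord (X k) n) \<longlonglongrightarrow> l n"
    by (intro choice allI) (simp add: Cauchy_convergent_iff convergent_def)
  then obtain l where l: "\<And>n. (\<lambda>k. coord (X k) n) \<longlonglongrightarrow> l n" by blast
  have fin: "sum (\<lambda>n. (cmod (coord (X j) n - l n))\<^sup>2) F \<le> e\<^sup>2"
    if M: "\<And>j k. j \<ge> M \<Longrightarrow> k \<ge> M \<Longrightarrow> dist (X j) (X k) < e" and "j \<ge> M" and "finite F" for e M j F
  proof (rule tendsto_upperbound)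
    show "(\<lambda>k. sum (\<lambda>n. (cmod (coord (X j) n - coord (X k) n))\<^sup>2) F)
        \<longlonglongrightarrow> sum (\<lambda>n. (cmod (coord (X j) n - l n))\<^sup>2) F"
      by (intro tendsto_intros l)
    show "\<forall>\<^sub>F k in sequentially. sum (\<lambda>n. (cmod (coord (X j) n - coord (X k) n))\<^sup>2) F \<le> e\<^sup>2"
    proof (rule eventually_sequentiallyI)
      fix k assume "k \<ge> M"
      have "sum (\<lambda>n. (cmod (coord (X j - X k) n))\<^sup>2) F \<le> (norm (X j - X k))\<^sup>2"
        unfolding norm_ell2_square
        by (rule finite_sum_le_infsum) (use \<open>finite F\<close> in \<open>auto intro: square_summable_coord simp del: coord_diff\<close>)
      also have "\<dots> \<le> e\<^sup>2"
        using M[OF \<open>j \<ge> M\<close> \<open>k \<ge> M\<close>] by (intro power_mono) (auto simp: dist_norm)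
      finally show "sum (\<lambda>n. (cmod (coord (X j) n - coord (X k) n))\<^sup>2) F \<le> e\<^sup>2" by simp
    qed
  qed simp
  have bnd: "(\<lambda>n. (cmod (coord (X j) n - l n))\<^sup>2) summable_on UNIV \<and>
      (\<Sum>\<^sub>\<infinity>n. (cmod (coord (X j) n - l n))\<^sup>2) \<le> e\<^sup>2"
    if M: "\<And>j k. j \<ge> M \<Longrightarrow> k \<ge> M \<Longrightarrow> dist (X j) (X k) < e" and "j \<ge> M" for e M j
  proof
    show s: "(\<lambda>n. (cmod (coord (X j) n - l n))\<^sup>2) summable_on UNIV"
      by (rule nonneg_bdd_above_summable_on)
        (use fin[OF M \<open>j \<ge> M\<close>] in \<open>auto intro!: bdd_aboveI[where M = "e\<^sup>2"]\<close>)
    show "(\<Sum>\<^sub>\<infinity>n. (cmod (coord (X j) n - l n))\<^sup>2) \<le> e\<^sup>2"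
      by (rule infsum_le_finite_sums[OF s]) (use fin[OF M \<open>j \<ge> M\<close>] in auto)
  qed
  obtain M1 where M1: "\<And>j k. j \<ge> M1 \<Longrightarrow> k \<ge> M1 \<Longrightarrow> dist (X j) (X k) < 1"
    using C unfolding Cauchy_def by (meson zero_less_one)
  have "(\<lambda>n. (cmod (coord (X M1) n + - 1 * (coord (X M1) n - l n)))\<^sup>2) summable_on UNIV"
    by (intro square_summable_add square_summable_mult square_summable_coord)
      (use bnd[OF M1 order_refl] in auto)
  then have sl: "(\<lambda>n. (cmod (l n))\<^sup>2) summable_on UNIV" by simp
  define L where "L = Abs_ell2 l"
  have L: "coord L = l" unfolding L_def using sl by (simp add: Abs_ell2_inverse)
  have "X \<longlonglongrightarrow> L"
  proof (rule metric_LIMSEQ_I)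
    fix e :: real assume "e > 0"
    then have "e / 2 > 0" by simp
    then obtain M where M: "\<And>j k. j \<ge> M \<Longrightarrow> k \<ge> M \<Longrightarrow> dist (X j) (X k) < e / 2"
      using C unfolding Cauchy_def by meson
    have "dist (X j) L < e" if "j \<ge> M" for j
    proof -
      have "(norm (X j - L))\<^sup>2 \<le> (e / 2)\<^sup>2"
        using bnd[OF M that] by (simp add: norm_ell2_square L)
      then have "norm (X j - L) \<le> e / 2"
        using \<open>e > 0\<close> by (simp add: power2_le_iff_abs_le)
      then show ?thesis using \<open>e > 0\<close> by (simp add: dist_norm)
    qed
    then show "\<exists>M. \<forall>j\<ge>M. dist (X j) L < e" by blast
  qed
  then show "convergent X" by (rule convergentI)
qed

global_interpretation ell2: vector_space cscale
  by standard (rule ell2_eqI; simp add: algebra_simps)+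

lemma norm_cscale: "norm (c *\<^sub>C x) = cmod c * norm x"
  by (simp add: norm_ell2_def norm_mult power_mult_distrib infsum_cmult_right' real_sqrt_mult)

lemma cinner_basis_vec: "cinner (basis_vec n) x = coord x n"
proof -
  have "cinner (basis_vec n) x = (\<Sum>\<^sub>\<infinity>k\<in>{n}. cnj (coord (basis_vec n) k) * coord x k)"
    unfolding cinner_def by (rule infsum_cong_neutral) auto
  then show ?thesis by simp
qed

section \<open>Bounded operators, spectrum and Riesz projections\<close>

text \<open>The type \<^typ>\<open>ell2 \<Rightarrow>\<^sub>L ell2\<close> consists of the bounded \<^emph>\<open>real\<close>-linear maps, so
  complex linearity is a separate predicate.\<close>

definition complex_linear :: "(ell2 \<Rightarrow>\<^sub>L ell2) \<Rightarrow> bool" where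
  "complex_linear A \<longleftrightarrow> Vector_Spaces.linear cscale cscale (blinfun_apply A)"

definition matrix_entry :: "(ell2 \<Rightarrow>\<^sub>L ell2) \<Rightarrow> int \<Rightarrow> int \<Rightarrow> complex" where
  "matrix_entry A n m = cinner (basis_vec n) (blinfun_apply A (basis_vec m))"

lift_definition scalar_op :: "complex \<Rightarrow> ell2 \<Rightarrow>\<^sub>L ell2" is "\<lambda>c x. c *\<^sub>C x"
proof -
  fix c :: complex
  show "bounded_linear (\<lambda>x. c *\<^sub>C x)"
    by (rule bounded_linear_intro[where K = "cmod c"])
      (auto intro!: ell2_eqI simp: algebra_simps norm_cscale)
qed

text \<open>For complex-linear \<open>A\<close> a two-sided inverse of \<open>z - A\<close> is automatically complex linear,
  so it makes no difference that \<open>R\<close> ranges over all bounded real-linear maps.\<close>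

definition is_resolvent_at :: "(ell2 \<Rightarrow>\<^sub>L ell2) \<Rightarrow> complex \<Rightarrow> (ell2 \<Rightarrow>\<^sub>L ell2) \<Rightarrow> bool" where
  "is_resolvent_at A z R \<longleftrightarrow>
     R o\<^sub>L (scalar_op z - A) = id_blinfun \<and> (scalar_op z - A) o\<^sub>L R = id_blinfun"

definition spectrum :: "(ell2 \<Rightarrow>\<^sub>L ell2) \<Rightarrow> complex set" where
  "spectrum A = {z. \<nexists>R. is_resolvent_at A z R}"

definition resolvent :: "(ell2 \<Rightarrow>\<^sub>L ell2) \<Rightarrow> complex \<Rightarrow> (ell2 \<Rightarrow>\<^sub>L ell2)" where
  "resolvent A z = (THE R. is_resolvent_at A z R)"

lemma resolvent_eqI:
  assumes "is_resolvent_at A z R"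
  shows "resolvent A z = R"
  unfolding resolvent_def
proof (rule the_equality, fact assms)
  fix S assume "is_resolvent_at A z S"
  with assms have "S x = R x" for x
    unfolding is_resolvent_at_def
    by (metis blinfun_apply_blinfun_compose blinfun_apply_id_blinfun)
  then show "S = R" by (rule blinfun_eqI)
qed

text \<open>\<open>1 / (2 \<pi> \<i>)\<close> times the integral, in operator norm, of the resolvent over the positively
  oriented circle of radius \<open>r\<close> about \<open>z\<close>.\<close>

definition riesz_projection :: "(ell2 \<Rightarrow>\<^sub>L ell2) \<Rightarrow> complex \<Rightarrow> real \<Rightarrow> (ell2 \<Rightarrow>\<^sub>L ell2)" where
  "riesz_projection A z r = scalar_op (1 / (2 * of_real pi * \<i>)) o\<^sub>L
     integral {0..1} (\<lambda>t. scalar_op (vector_derivative (circlepath z r) (at t))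
       o\<^sub>L resolvent A (circlepath z r t))"

definition finite_rank :: "(ell2 \<Rightarrow>\<^sub>L ell2) \<Rightarrow> bool" where
  "finite_rank A \<longleftrightarrow> (\<exists>B. finite B \<and> range (blinfun_apply A) \<subseteq> ell2.span B)"

text \<open>The closed disc separates \<open>z\<close> from the rest of the spectrum; the Riesz projection does
  not depend on the choice of such a radius.\<close>

definition disc_spectrum :: "(ell2 \<Rightarrow>\<^sub>L ell2) \<Rightarrow> complex set" where
  "disc_spectrum A = {z. z isolated_in spectrum A \<and>
     (\<exists>r>0. cball z r \<inter> spectrum A = {z} \<and> finite_rank (riesz_projection A z r))}"

section \<open>The discrete Laplacian and exponentially weighted sequences\<close>

lift_definition shift :: "int \<Rightarrow> ell2 \<Rightarrow> ell2" is "\<lambda>k x n. x (n + k)"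
  by (rule square_summable_shift)

lemma coord_shift [simp]: "coord (shift k x) n = coord x (n + k)"
  by (simp add: shift.rep_eq)

lemma norm_shift: "norm (shift k x) = norm x"
proof -
  have "bij_betw (\<lambda>n::int. n + k) UNIV UNIV"
    by (rule bij_betwI[where g = "\<lambda>n. n - k"]) auto
  from infsum_reindex_bij_betw[OF this, of "\<lambda>n. (cmod (coord x n))\<^sup>2"]
  show ?thesis by (simp add: norm_ell2_def)
qed

lift_definition H0 :: "ell2 \<Rightarrow>\<^sub>L ell2" is "\<lambda>x. 2 *\<^sub>C x - shift 1 x - shift (- 1) x"
proof -
  have "bounded_linear (shift k)" for k
    by (rule bounded_linear_intro[where K = 1]) (auto intro!: ell2_eqI simp: norm_shift)
  moreover have "bounded_linear (\<lambda>x. 2 *\<^sub>C x)"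
    using blinfun.bounded_linear_right[of "scalar_op 2"] by (simp add: scalar_op.rep_eq)
  ultimately show "bounded_linear (\<lambda>x. 2 *\<^sub>C x - shift 1 x - shift (- 1) x)"
    by (intro bounded_linear_sub)
qed

lemma coord_H0: "coord (H0 x) n = 2 * coord x n - coord x (n + 1) - coord x (n - 1)"
  by (simp add: H0.rep_eq)

lemma complex_linear_H0: "complex_linear H0"
  unfolding complex_linear_def Vector_Spaces.linear_iff
  by (auto intro!: ell2_eqI simp: coord_H0 algebra_simps ell2.vector_space_axioms)

definition weighted_ell2 :: "real \<Rightarrow> ell2 set" where
  "weighted_ell2 \<delta> =
     {x. (\<lambda>n. exp (\<delta> * of_int \<bar>n\<bar>) * (cmod (coord x n))\<^sup>2) summable_on UNIV}"

definition complex_rect :: "real set \<Rightarrow> real set \<Rightarrow> complex set" where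
  "complex_rect \<Delta>1 \<Delta>2 = {z. Re z \<in> \<Delta>1 \<and> Im z \<in> \<Delta>2}"

end

theory Submission
  imports Defs
begin

text \<open>
  Parametrise \<open>z = 2 - w - 1/w\<close> with \<open>\<bar>w\<bar> < 1\<close>, put \<open>q = exp (- \<delta>/2)\<close>, let \<open>W\<close> be multiplication by
  \<open>q^\<bar>n\<bar>\<close> and write \<open>V = W K W\<close>, where \<open>K\<close> still has an exponentially decaying kernel. The resolvent
  \<open>(H\<^sub>V - z)\<^sup>-\<^sup>1\<close> between weighted vectors is governed by the inverse of \<open>1 + K T(w)\<close>, where
  \<open>T(w) = W (H\<^sub>0 - z)\<^sup>-\<^sup>1 W\<close> has the kernel \<open>q^(\<bar>n\<bar>+\<bar>m\<bar>) w^(\<bar>n-m\<bar>+1) / (1 - w\<^sup>2)\<close>. This continues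
  meromorphically to a disc of radius \<open>\<rho> > 1\<close>, with poles at \<open>\<plusminus>1\<close> of finite rank. Splitting \<open>K\<close> into a
  small and a finite rank part, and adding the finite rank terms one at a time by the
  Sherman--Morrison formula, gives a scalar holomorphic function \<open>d\<close> with \<open>d(0) \<noteq> 0\<close> and an operator
  family \<open>G\<close>, holomorphic on the disc, such that \<open>(1 - w\<^sup>2) (1 + K T(w))\<close> has the inverse \<open>G(w) / d(w)\<close>.
  The finitely many zeros of \<open>d\<close> in the closed unit disc account for the discrete spectrum and for
  \<open>D'\<close>; points of \<open>[0,4]\<close> are in the spectrum by a Weyl sequence, hence never isolated in it.
\<close>

section \<open>Complex-linear operators and matrix entries\<close>

lemma complex_linearD: "complex_linear A \<Longrightarrow> A (c *\<^sub>C x) = c *\<^sub>C A x"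
  by (simp add: complex_linear_def Vector_Spaces.linear_iff)

lemma complex_linearI: "(\<And>c x. blinfun_apply A (c *\<^sub>C x) = c *\<^sub>C A x) \<Longrightarrow> complex_linear A"
  by (simp add: complex_linear_def Vector_Spaces.linear_iff ell2.vector_space_axioms
      blinfun.add_right)

lemma complex_linear_id: "complex_linear id_blinfun"
  by (rule complex_linearI) simp

lemma complex_linear_zero: "complex_linear 0"
  by (rule complex_linearI) simp

lemma complex_linear_scalar_op: "complex_linear (scalar_op c)"
  by (rule complex_linearI) (simp add: scalar_op.rep_eq mult.commute)

lemma complex_linear_compose:
  "complex_linear A \<Longrightarrow> complex_linear B \<Longrightarrow> complex_linear (A o\<^sub>L B)"
  by (rule complex_linearI) (simp add: complex_linearD)

lemma complex_linear_add: "complex_linear A \<Longrightarrow> complex_linear B \<Longrightarrow> complex_linear (A + B)"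
  by (rule complex_linearI) (simp add: complex_linearD blinfun.add_left ell2.scale_right_distrib)

lemma complex_linear_diff: "complex_linear A \<Longrightarrow> complex_linear B \<Longrightarrow> complex_linear (A - B)"
  by (rule complex_linearI)
    (simp add: complex_linearD blinfun.diff_left ell2.scale_right_diff_distrib)

lemmas complex_linear_intros =
  complex_linear_id complex_linear_zero complex_linear_scalar_op complex_linear_compose
  complex_linear_add complex_linear_diff

lemma complex_linear_inverse:
  assumes "complex_linear A" "A o\<^sub>L B = id_blinfun" "B o\<^sub>L A = id_blinfun"
  shows "complex_linear B"
proof (rule complex_linearI)
  fix c x
  have AB: "A (B y) = y" and BA: "B (A y) = y" for y
    using assms(2,3) by (metis blinfun_apply_blinfun_compose blinfun_apply_id_blinfun)+
  have "c *\<^sub>C x = A (c *\<^sub>C B x)"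
    by (simp add: complex_linearD[OF assms(1)] AB)
  then show "B (c *\<^sub>C x) = c *\<^sub>C B x"
    by (simp add: BA)
qed

lemma scalar_op_apply [simp]: "scalar_op c x = c *\<^sub>C x"
  by (simp add: scalar_op.rep_eq)

lemma bounded_linear_scalar_op: "bounded_linear scalar_op"
proof (rule bounded_linear_intro[where K = 1])
  show "norm (scalar_op c) \<le> norm c * 1" for c
    by (rule norm_blinfun_bound) (auto simp: norm_cscale)
qed (rule blinfun_eqI, rule ell2_eqI, simp add: blinfun.add_left blinfun.scaleR_left scaleR_conv_of_real algebra_simps)+

section \<open>Norm comparison, the complex inner product and rank one operators\<close>

lemma norm_le_of_coord_le:
  assumes "\<And>n. cmod (coord x n) \<le> b * cmod (coord y n)" "b \<ge> 0"
  shows "norm x \<le> b * norm y"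
proof -
  have "(norm x)\<^sup>2 \<le> (\<Sum>\<^sub>\<infinity>n. b\<^sup>2 * (cmod (coord y n))\<^sup>2)"
    unfolding norm_ell2_square
  proof (rule infsum_mono)
    show "(cmod (coord x n))\<^sup>2 \<le> b\<^sup>2 * (cmod (coord y n))\<^sup>2" for n
      using power_mono[OF assms(1), of n 2] by (simp add: power_mult_distrib)
  qed (intro summable_on_cmult_right square_summable_coord)+
  also have "\<dots> = (b * norm y)\<^sup>2"
    by (simp add: infsum_cmult_right' power_mult_distrib norm_ell2_square)
  finally show ?thesis
    by (rule power2_le_imp_le) (simp add: assms)
qed

text \<open>The real inner product is only the real part of \<open>cinner\<close>, so the real
  Cauchy-Schwarz inequality bounds that part alone. Multiplying \<open>y\<close> by the conjugate
  phase of \<open>cinner x y\<close> makes the whole value real and nonnegative.\<close>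

lemma norm_cinner_le: "cmod (cinner x y) \<le> norm x * norm y"
proof -
  define c where "c = cnj (sgn (cinner x y))"
  have "cinner x (c *\<^sub>C y) = c * cinner x y"
    by (simp add: cinner_def infsum_cmult_right' algebra_simps flip: infsum_cmult_right')
  also have "\<dots> = of_real (cmod (cinner x y))"
    by (cases "cinner x y = 0")
      (auto simp: c_def sgn_eq complex_norm_square[symmetric] mult.commute[of "cnj _"]
        power2_eq_square)
  finally have "cmod (cinner x y) = inner x (c *\<^sub>C y)"
    by (simp add: inner_ell2_def)
  also have "\<dots> \<le> norm x * norm (c *\<^sub>C y)"
    by (rule norm_cauchy_schwarz)
  also have "\<dots> \<le> norm x * norm y"
    by (simp add: norm_cscale c_def norm_sgn mult_left_le)
  finally show ?thesis .
qed

lemma cinner_add_right: "cinner x (y + z) = cinner x y + cinner x z"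
  by (simp add: cinner_def distrib_left infsum_add cinner_summable)

lemma cinner_cscale_right: "cinner x (c *\<^sub>C y) = c * cinner x y"
  by (simp add: cinner_def mult.left_commute flip: infsum_cmult_right')

lemma bounded_linear_cinner: "bounded_linear (cinner x)"
proof (rule bounded_linear_intro[where K = "norm x"])
  show "cinner x (r *\<^sub>R y) = r *\<^sub>R cinner x y" for r y
    by (simp add: scaleR_ell2_def cinner_cscale_right scaleR_conv_of_real)
qed (simp_all add: cinner_add_right norm_cinner_le mult.commute[of "norm _" "norm x"])

lift_definition rank_one :: "ell2 \<Rightarrow> ell2 \<Rightarrow> ell2 \<Rightarrow>\<^sub>L ell2" is "\<lambda>f g x. cinner g x *\<^sub>C f"
proof -
  fix f g
  show "bounded_linear (\<lambda>x. cinner g x *\<^sub>C f)"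
  proof (rule bounded_linear_intro[where K = "norm g * norm f"])
    show "norm (cinner g x *\<^sub>C f) \<le> norm x * (norm g * norm f)" for x
      using mult_right_mono[OF norm_cinner_le[of g x], of "norm f"]
      by (simp add: norm_cscale mult_ac)
  qed (simp_all add: cinner_add_right ell2.scale_left_distrib scaleR_ell2_def cinner_cscale_right)
qed

lemma complex_linear_rank_one: "complex_linear (rank_one f g)"
  by (rule complex_linearI) (simp add: rank_one.rep_eq cinner_cscale_right)

section \<open>Geometric sequences over the integers\<close>

lemma summable_on_geometric_int:
  fixes r :: real
  assumes "0 \<le> r" "r < 1"
  shows "(\<lambda>n::int. r ^ nat \<bar>n\<bar>) summable_on UNIV"
proof -
  have nat: "(\<lambda>n::nat. r ^ n) summable_on UNIV"
    using assms by (intro norm_summable_imp_summable_on) (auto intro: summable_geometric)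
  have 1: "(\<lambda>n::int. r ^ nat \<bar>n\<bar>) summable_on range int"
    by (subst summable_on_reindex) (auto simp: o_def nat)
  have 2: "(\<lambda>n::int. r ^ nat \<bar>n\<bar>) summable_on range (\<lambda>n. - int n)"
    by (subst summable_on_reindex) (auto simp: o_def nat inj_def)
  have "range int \<union> range (\<lambda>n. - int n) = UNIV"
    by (metis (no_types, lifting) UNIV_eq_I UnCI int_cases2 rangeI)
  with summable_on_union[OF 1 2] show ?thesis by simp
qed

text \<open>A geometric majorant gives square summability, so \<open>f\<close> lies in the domain on
  which \<open>coord\<close> inverts \<open>Abs_ell2\<close>.\<close>

lemma coord_Abs_ell2:
  fixes f :: "int \<Rightarrow> complex"
  assumes "0 \<le> r" "r < 1" "\<And>n. cmod (f n) \<le> C * r ^ nat \<bar>n\<bar>"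
  shows "coord (Abs_ell2 f) = f"
proof -
  have "(\<lambda>n. (cmod (f n))\<^sup>2) summable_on UNIV"
  proof (rule summable_on_comparison_test)
    show "(\<lambda>n::int. C\<^sup>2 * (r\<^sup>2) ^ nat \<bar>n\<bar>) summable_on UNIV"
      using assms by (intro summable_on_cmult_right summable_on_geometric_int)
        (auto simp: power_less_one_iff)
    show "(cmod (f n))\<^sup>2 \<le> C\<^sup>2 * (r\<^sup>2) ^ nat \<bar>n\<bar>" for n
      using power_mono[OF assms(3), of n 2]
      by (simp add: power_mult_distrib flip: power_mult) (simp add: mult.commute)
  qed auto
  then show ?thesis by (simp add: Abs_ell2_inverse)
qed

text \<open>Meaningful for \<open>cmod w < 1\<close>. Shifted and rescaled, it is a column of the
  free resolvent kernel; at \<open>q\<close> and \<open>- q\<close> it yields the rank one terms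
  that carry the poles at 1 and -1.\<close>

definition geo_vec :: "complex \<Rightarrow> ell2" where
  "geo_vec w = Abs_ell2 (\<lambda>n. w ^ nat \<bar>n\<bar>)"

lemma coord_geo_vec: "cmod w < 1 \<Longrightarrow> coord (geo_vec w) n = w ^ nat \<bar>n\<bar>"
  unfolding geo_vec_def
  by (subst coord_Abs_ell2[where r = "cmod w" and C = 1]) (auto simp: norm_power)

section \<open>Expansion in the canonical basis and recovery of an operator from its matrix\<close>

lemma coord_sum: "coord (sum f F) n = (\<Sum>m\<in>F. coord (f m) n)"
  by (induction F rule: infinite_finite_induct) auto

text \<open>The squared distance from \<open>x\<close> to its partial sum over \<open>F\<close> is
  the squared norm of \<open>x\<close> minus the sum of the squared moduli over \<open>F\<close>,
  which tends to 0.\<close>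

lemma has_sum_basis: "((\<lambda>m. coord x m *\<^sub>C basis_vec m) has_sum x) UNIV"
  unfolding has_sum_def
proof (rule tendstoI)
  fix e :: real assume "e > 0"
  have "((\<lambda>n. (cmod (coord x n))\<^sup>2) has_sum (norm x)\<^sup>2) UNIV"
    unfolding norm_ell2_square by (rule has_sum_infsum[OF square_summable_coord])
  then have "\<forall>\<^sub>F F in finite_subsets_at_top UNIV.
      dist (\<Sum>n\<in>F. (cmod (coord x n))\<^sup>2) ((norm x)\<^sup>2) < e\<^sup>2"
    using \<open>e > 0\<close> unfolding has_sum_def by (intro tendstoD) auto
  moreover have "\<forall>\<^sub>F F in finite_subsets_at_top (UNIV :: int set). finite F"
    by (metis (mono_tags, lifting) eventually_finite_subsets_at_top_weakI)
  ultimately show "\<forall>\<^sub>F F in finite_subsets_at_top UNIV.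
      dist (\<Sum>m\<in>F. coord x m *\<^sub>C basis_vec m) x < e"
  proof eventually_elim
    case (elim F)
    define y where "y = (\<Sum>m\<in>F. coord x m *\<^sub>C basis_vec m)"
    have y: "coord y n = (if n \<in> F then coord x n else 0)" for n
      using elim(2) by (auto simp: y_def coord_sum if_distrib sum.If_cases cong: if_cong)
    have "(norm (y - x))\<^sup>2 = (\<Sum>\<^sub>\<infinity>n\<in>- F. (cmod (coord x n))\<^sup>2)"
      unfolding norm_ell2_square by (rule infsum_cong_neutral) (auto simp: y)
    also have "\<dots> = (norm x)\<^sup>2 - (\<Sum>n\<in>F. (cmod (coord x n))\<^sup>2)"
      unfolding norm_ell2_square Compl_eq_Diff_UNIV
      by (subst infsum_Diff) (use elim(2) in \<open>auto intro: square_summable_coord\<close>)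
    also have "\<dots> < e\<^sup>2"
      using elim(1) by (simp add: dist_real_def)
    finally have "norm (y - x) < e"
      using \<open>e > 0\<close> by (simp add: power_less_imp_less_base)
    then show ?case by (simp add: y_def dist_norm)
  qed
qed

lemma bounded_linear_coord: "bounded_linear (\<lambda>x. coord x n)"
  by (rule bounded_linear_intro[where K = 1])
    (auto simp: scaleR_conv_of_real norm_coord_le)

lemma matrix_entry_eq: "matrix_entry A n m = coord (A (basis_vec m)) n"
  by (simp add: matrix_entry_def cinner_basis_vec)

lemma has_sum_matrix_entry:
  assumes "complex_linear A"
  shows "((\<lambda>m. matrix_entry A n m * coord x m) has_sum coord (A x) n) UNIV"
proof -
  have "bounded_linear (\<lambda>x. coord (A x) n)"
    by (rule bounded_linear_compose[OF bounded_linear_coord blinfun.bounded_linear_right])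
  from has_sum_bounded_linear[OF this has_sum_basis[of x]] show ?thesis
    by (simp add: o_def complex_linearD[OF assms] matrix_entry_eq mult.commute)
qed

text \<open>Reduces operator identities to identities between kernels. Complex linearity is
  essential: coordinatewise conjugation is real linear and agrees with the identity on every basis
  vector.\<close>

lemma eq_by_matrix_entries:
  assumes "complex_linear A" "complex_linear B" "\<And>n m. matrix_entry A n m = matrix_entry B n m"
  shows "A = B"
proof (rule blinfun_eqI, rule ell2_eqI)
  fix x n
  show "coord (A x) n = coord (B x) n"
    using has_sum_unique has_sum_matrix_entry[OF assms(1), of n x]
      has_sum_matrix_entry[OF assms(2), of n x] unfolding assms(3) by blast
qed

section \<open>Operators with exponentially decaying kernels\<close>

text \<open>Decay away from the origin in both variables, not just away from the diagonal. For
  \<open>r < 1\<close> the kernel is dominated by a product of two geometric sequences, which makes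
  the operator compact.\<close>

definition decaying :: "real \<Rightarrow> real \<Rightarrow> (int \<Rightarrow> int \<Rightarrow> complex) \<Rightarrow> bool" where
  "decaying r C k \<longleftrightarrow> (\<forall>n m. cmod (k n m) \<le> C * r ^ (nat \<bar>n\<bar> + nat \<bar>m\<bar>))"

text \<open>Meaningful only for kernels that define a bounded operator; otherwise \<open>Abs_ell2\<close> and \<open>Blinfun\<close>
  are applied outside their domain.\<close>

definition kernel_op :: "(int \<Rightarrow> int \<Rightarrow> complex) \<Rightarrow> (ell2 \<Rightarrow>\<^sub>L ell2)" where
  "kernel_op k = Blinfun (\<lambda>x. Abs_ell2 (\<lambda>n. \<Sum>\<^sub>\<infinity>m. k n m * coord x m))"

text \<open>An operator norm bound for the model kernel
  \<open>r ^ (\<bar>n\<bar> + \<bar>m\<bar>)\<close>: coordinates of the argument are bounded by its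
  norm, the sum over \<open>m\<close> is geometric, and the dependence on \<open>n\<close>
  contributes an \<open>ell2\<close> norm.\<close>

definition geo_const :: "real \<Rightarrow> real" where
  "geo_const r = (\<Sum>\<^sub>\<infinity>m::int. r ^ nat \<bar>m\<bar>) * norm (geo_vec (of_real r))"

context
  fixes r C :: real and k :: "int \<Rightarrow> int \<Rightarrow> complex"
  assumes r: "0 \<le> r" "r < 1" and k: "decaying r C k"
begin

lemma decaying_nonneg: "C \<ge> 0"
proof -
  have "0 \<le> cmod (k 0 0)" by simp
  also have "\<dots> \<le> C" using k unfolding decaying_def by (metis add_0 abs_zero nat_0 power_0 mult_1_right)
  finally show ?thesis .
qed

lemma kernel_term_le: "cmod (k n m * coord x m) \<le> C * r ^ nat \<bar>n\<bar> * norm x * r ^ nat \<bar>m\<bar>"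
proof -
  have "cmod (k n m * coord x m) \<le> (C * r ^ (nat \<bar>n\<bar> + nat \<bar>m\<bar>)) * norm x"
    unfolding norm_mult using k r decaying_nonneg
    by (intro mult_mono norm_coord_le) (auto simp: decaying_def)
  then show ?thesis by (simp add: power_add mult_ac)
qed

lemma kernel_abs_summable: "(\<lambda>m. cmod (k n m * coord x m)) summable_on UNIV"
  by (rule summable_on_comparison_test[OF _ kernel_term_le])
    (auto intro!: summable_on_cmult_right summable_on_geometric_int r)

lemma kernel_summable: "(\<lambda>m. k n m * coord x m) summable_on UNIV"
  by (rule abs_summable_summable[OF kernel_abs_summable])

lemma kernel_infsum_le:
  "cmod (\<Sum>\<^sub>\<infinity>m. k n m * coord x m) \<le> C * (\<Sum>\<^sub>\<infinity>m::int. r ^ nat \<bar>m\<bar>) * norm x * r ^ nat \<bar>n\<bar>"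
proof -
  have "cmod (\<Sum>\<^sub>\<infinity>m. k n m * coord x m) \<le> (\<Sum>\<^sub>\<infinity>m. cmod (k n m * coord x m))"
    by (rule norm_infsum_bound[OF kernel_abs_summable])
  also have "\<dots> \<le> (\<Sum>\<^sub>\<infinity>m::int. C * r ^ nat \<bar>n\<bar> * norm x * r ^ nat \<bar>m\<bar>)"
    by (intro infsum_mono kernel_abs_summable kernel_term_le summable_on_cmult_right
        summable_on_geometric_int r)
  also have "\<dots> = C * r ^ nat \<bar>n\<bar> * norm x * (\<Sum>\<^sub>\<infinity>m::int. r ^ nat \<bar>m\<bar>)"
    by (rule infsum_cmult_right')
  finally show ?thesis
    by (simp only: mult_ac)
qed

lemma coord_Abs_kernel:
  "coord (Abs_ell2 (\<lambda>n. \<Sum>\<^sub>\<infinity>m. k n m * coord x m)) = (\<lambda>n. \<Sum>\<^sub>\<infinity>m. k n m * coord x m)"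
  by (rule coord_Abs_ell2[OF r kernel_infsum_le])

lemma norm_Abs_kernel:
  "norm (Abs_ell2 (\<lambda>n. \<Sum>\<^sub>\<infinity>m. k n m * coord x m)) \<le> norm x * (C * geo_const r)"
proof -
  have nn: "0 \<le> (\<Sum>\<^sub>\<infinity>m::int. r ^ nat \<bar>m\<bar>)"
    by (intro infsum_nonneg) (use r in auto)
  have "norm (Abs_ell2 (\<lambda>n. \<Sum>\<^sub>\<infinity>m. k n m * coord x m))
      \<le> (C * (\<Sum>\<^sub>\<infinity>m::int. r ^ nat \<bar>m\<bar>) * norm x) * norm (geo_vec (of_real r))"
    using kernel_infsum_le[where x = x] nn decaying_nonneg r
    by (intro norm_le_of_coord_le) (auto simp: coord_Abs_kernel coord_geo_vec norm_power)
  then show ?thesis by (simp add: geo_const_def mult_ac)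
qed

lemma bounded_linear_kernel:
  "bounded_linear (\<lambda>x. Abs_ell2 (\<lambda>n. \<Sum>\<^sub>\<infinity>m. k n m * coord x m))"
proof (rule bounded_linear_intro[OF _ _ norm_Abs_kernel])
  show "Abs_ell2 (\<lambda>n. \<Sum>\<^sub>\<infinity>m. k n m * coord (x + y) m) =
      Abs_ell2 (\<lambda>n. \<Sum>\<^sub>\<infinity>m. k n m * coord x m) + Abs_ell2 (\<lambda>n. \<Sum>\<^sub>\<infinity>m. k n m * coord y m)" for x y
  proof (rule ell2_eqI)
    have "(\<Sum>\<^sub>\<infinity>m. k n m * coord (x + y) m) =
        (\<Sum>\<^sub>\<infinity>m. k n m * coord x m) + (\<Sum>\<^sub>\<infinity>m. k n m * coord y m)" for n
      by (simp only: coord_add distrib_left infsum_add[OF kernel_summable kernel_summable])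
    then show "coord (Abs_ell2 (\<lambda>n. \<Sum>\<^sub>\<infinity>m. k n m * coord (x + y) m)) n =
        coord (Abs_ell2 (\<lambda>n. \<Sum>\<^sub>\<infinity>m. k n m * coord x m) +
          Abs_ell2 (\<lambda>n. \<Sum>\<^sub>\<infinity>m. k n m * coord y m)) n" for n
      unfolding coord_add[of "Abs_ell2 _"] coord_Abs_kernel by simp
  qed
  show "Abs_ell2 (\<lambda>n. \<Sum>\<^sub>\<infinity>m. k n m * coord (a *\<^sub>R x) m) =
      a *\<^sub>R Abs_ell2 (\<lambda>n. \<Sum>\<^sub>\<infinity>m. k n m * coord x m)" for a x
  proof (rule ell2_eqI)
    have "(\<Sum>\<^sub>\<infinity>m. k n m * coord (a *\<^sub>R x) m) = of_real a * (\<Sum>\<^sub>\<infinity>m. k n m * coord x m)" for n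
      by (simp only: coord_scaleR mult.left_commute[of _ "of_real a"] infsum_cmult_right')
    then show "coord (Abs_ell2 (\<lambda>n. \<Sum>\<^sub>\<infinity>m. k n m * coord (a *\<^sub>R x) m)) n =
        coord (a *\<^sub>R Abs_ell2 (\<lambda>n. \<Sum>\<^sub>\<infinity>m. k n m * coord x m)) n" for n
      unfolding coord_scaleR[of _ "Abs_ell2 _"] coord_Abs_kernel by simp
  qed
qed

lemma coord_kernel_op: "coord (kernel_op k x) n = (\<Sum>\<^sub>\<infinity>m. k n m * coord x m)"
  unfolding kernel_op_def by (simp add: bounded_linear_Blinfun_apply[OF bounded_linear_kernel] coord_Abs_kernel)

lemma norm_kernel_op: "norm (kernel_op k) \<le> C * geo_const r"
proof (rule norm_blinfun_bound)
  have "0 \<le> geo_const r"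
    unfolding geo_const_def by (intro mult_nonneg_nonneg infsum_nonneg) (use r in auto)
  then show "0 \<le> C * geo_const r" using decaying_nonneg by simp
  show "norm (kernel_op k x) \<le> C * geo_const r * norm x" for x
    unfolding kernel_op_def bounded_linear_Blinfun_apply[OF bounded_linear_kernel]
    using norm_Abs_kernel[of x] by (simp add: mult_ac)
qed

lemma complex_linear_kernel_op: "complex_linear (kernel_op k)"
  by (rule complex_linearI, rule ell2_eqI)
    (simp add: coord_kernel_op mult.left_commute flip: infsum_cmult_right')

lemma matrix_entry_kernel_op: "matrix_entry (kernel_op k) n m = k n m"
proof -
  have "(\<Sum>\<^sub>\<infinity>j. k n j * coord (basis_vec m) j) = (\<Sum>\<^sub>\<infinity>j\<in>{m}. k n j * coord (basis_vec m) j)"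
    by (rule infsum_cong_neutral) auto
  then show ?thesis by (simp add: matrix_entry_eq coord_kernel_op)
qed

end

lemma matrix_entry_diff: "matrix_entry (A - B) n m = matrix_entry A n m - matrix_entry B n m"
  by (simp add: matrix_entry_eq blinfun.diff_left)

lemma matrix_entry_add: "matrix_entry (A + B) n m = matrix_entry A n m + matrix_entry B n m"
  by (simp add: matrix_entry_eq blinfun.add_left)

lemma matrix_entry_scalar_op: "matrix_entry (scalar_op c o\<^sub>L A) n m = c * matrix_entry A n m"
  by (simp add: matrix_entry_eq)

lemma matrix_entry_rank_one: "matrix_entry (rank_one f g) n m = coord f n * cnj (coord g m)"
proof -
  have "cinner g (basis_vec m) = (\<Sum>\<^sub>\<infinity>j\<in>{m}. cnj (coord g j) * coord (basis_vec m) j)"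
    unfolding cinner_def by (rule infsum_cong_neutral) auto
  then show ?thesis by (simp add: matrix_entry_eq rank_one.rep_eq mult.commute)
qed

section \<open>Holomorphic operator families\<close>

text \<open>\<^typ>\<open>ell2 \<Rightarrow>\<^sub>L ell2\<close> carries no complex structure, so a complex derivative \<open>D\<close> is encoded as the
  real derivative \<open>h \<mapsto> h D\<close>.\<close>

definition op_holomorphic_on :: "(complex \<Rightarrow> (ell2 \<Rightarrow>\<^sub>L ell2)) \<Rightarrow> complex set \<Rightarrow> bool"
    (infixl "(op'_holomorphic'_on)" 50) where
  "G op_holomorphic_on U \<longleftrightarrow> (\<forall>w\<in>U. complex_linear (G w) \<and>
     (\<exists>D. (G has_derivative (\<lambda>h. scalar_op h o\<^sub>L D)) (at w)))"

lemma blinfun_compose_assoc: "(A o\<^sub>L B) o\<^sub>L C = A o\<^sub>L (B o\<^sub>L C)"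
  by (rule blinfun_eqI) simp

lemma blinfun_compose_distribs:
  "A o\<^sub>L (B + C) = (A o\<^sub>L B) + (A o\<^sub>L C)" "(B + C) o\<^sub>L A = (B o\<^sub>L A) + (C o\<^sub>L A)"
  "A o\<^sub>L (B - C) = (A o\<^sub>L B) - (A o\<^sub>L C)" "(B - C) o\<^sub>L A = (B o\<^sub>L A) - (C o\<^sub>L A)"
  by (rule blinfun_eqI; simp add: blinfun.add_left blinfun.diff_left blinfun.add_right
      blinfun.diff_right)+

lemma scalar_op_compose: "scalar_op a o\<^sub>L scalar_op b = scalar_op (a * b)"
  by (rule blinfun_eqI, rule ell2_eqI) simp

lemma complex_linear_commute:
  "complex_linear A \<Longrightarrow> A o\<^sub>L (scalar_op c o\<^sub>L B) = scalar_op c o\<^sub>L (A o\<^sub>L B)"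
  by (rule blinfun_eqI) (simp add: complex_linearD)

lemma op_holomorphic_complex_linear:
  "G op_holomorphic_on U \<Longrightarrow> w \<in> U \<Longrightarrow> complex_linear (G w)"
  by (simp add: op_holomorphic_on_def)

lemma op_holomorphic_const: "complex_linear A \<Longrightarrow> (\<lambda>_. A) op_holomorphic_on U"
  unfolding op_holomorphic_on_def
  by (auto intro!: exI[of _ 0] simp: blinfun_compose_zero)

lemma op_holomorphic_add:
  assumes "F op_holomorphic_on U" "G op_holomorphic_on U"
  shows "(\<lambda>w. F w + G w) op_holomorphic_on U"
  unfolding op_holomorphic_on_def
proof (intro ballI conjI)
  fix w assume "w \<in> U"
  with assms obtain D E where
    "(F has_derivative (\<lambda>h. scalar_op h o\<^sub>L D)) (at w)"
    "(G has_derivative (\<lambda>h. scalar_op h o\<^sub>L E)) (at w)"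
    unfolding op_holomorphic_on_def by blast
  from has_derivative_add[OF this]
  have "((\<lambda>w. F w + G w) has_derivative (\<lambda>h. scalar_op h o\<^sub>L (D + E))) (at w)"
    by (simp add: blinfun_compose_distribs)
  then show "\<exists>D. ((\<lambda>w. F w + G w) has_derivative (\<lambda>h. scalar_op h o\<^sub>L D)) (at w)" ..
qed (use assms in \<open>auto intro: complex_linear_add simp: op_holomorphic_on_def\<close>)

lemma op_holomorphic_compose:
  assumes "F op_holomorphic_on U" "G op_holomorphic_on U"
  shows "(\<lambda>w. F w o\<^sub>L G w) op_holomorphic_on U"
  unfolding op_holomorphic_on_def
proof (intro ballI conjI)
  fix w assume "w \<in> U"
  with assms obtain D E where D:
    "(F has_derivative (\<lambda>h. scalar_op h o\<^sub>L D)) (at w)"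
    "(G has_derivative (\<lambda>h. scalar_op h o\<^sub>L E)) (at w)" and F: "complex_linear (F w)"
    unfolding op_holomorphic_on_def by blast
  from bounded_bilinear.FDERIV[OF bounded_bilinear_blinfun_compose D]
  have "((\<lambda>w. F w o\<^sub>L G w) has_derivative (\<lambda>h. scalar_op h o\<^sub>L ((F w o\<^sub>L E) + (D o\<^sub>L G w)))) (at w)"
    by (simp add: blinfun_compose_distribs complex_linear_commute[OF F] blinfun_compose_assoc)
  then show "\<exists>D. ((\<lambda>w. F w o\<^sub>L G w) has_derivative (\<lambda>h. scalar_op h o\<^sub>L D)) (at w)" ..
qed (use assms in \<open>auto intro: complex_linear_compose simp: op_holomorphic_on_def\<close>)

lemma op_holomorphic_scalar_op:
  assumes "f holomorphic_on U" "open U"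
  shows "(\<lambda>w. scalar_op (f w)) op_holomorphic_on U"
  unfolding op_holomorphic_on_def
proof (intro ballI conjI)
  fix w assume "w \<in> U"
  with assms have "(f has_field_derivative deriv f w) (at w)"
    by (rule holomorphic_derivI)
  then have "(f has_derivative (\<lambda>h. h * deriv f w)) (at w)"
    by (simp add: has_field_derivative_def mult.commute[of _ "deriv f w"])
  from bounded_linear.has_derivative[OF bounded_linear_scalar_op this]
  show "\<exists>D. ((\<lambda>w. scalar_op (f w)) has_derivative (\<lambda>h. scalar_op h o\<^sub>L D)) (at w)"
    by (auto simp: scalar_op_compose intro!: exI[of _ "scalar_op (deriv f w)"])
qed (rule complex_linear_scalar_op)

lemma op_holomorphic_diff:
  assumes "F op_holomorphic_on U" "G op_holomorphic_on U"
  shows "(\<lambda>w. F w - G w) op_holomorphic_on U"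
  unfolding op_holomorphic_on_def
proof (intro ballI conjI)
  fix w assume "w \<in> U"
  with assms obtain D E where
    "(F has_derivative (\<lambda>h. scalar_op h o\<^sub>L D)) (at w)"
    "(G has_derivative (\<lambda>h. scalar_op h o\<^sub>L E)) (at w)"
    unfolding op_holomorphic_on_def by blast
  from has_derivative_diff[OF this]
  have "((\<lambda>w. F w - G w) has_derivative (\<lambda>h. scalar_op h o\<^sub>L (D - E))) (at w)"
    by (simp add: blinfun_compose_distribs)
  then show "\<exists>D. ((\<lambda>w. F w - G w) has_derivative (\<lambda>h. scalar_op h o\<^sub>L D)) (at w)" ..
qed (use assms in \<open>auto intro: complex_linear_diff simp: op_holomorphic_on_def\<close>)

lemma op_holomorphic_continuous:
  "G op_holomorphic_on U \<Longrightarrow> continuous_on U G"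
  unfolding op_holomorphic_on_def
  by (meson continuous_at_imp_continuous_on has_derivative_continuous)

lemma op_holomorphic_cinner:
  assumes "G op_holomorphic_on U" "open U"
  shows "(\<lambda>w. cinner x (G w y)) holomorphic_on U"
  unfolding holomorphic_on_open[OF assms(2)]
proof
  fix w assume "w \<in> U"
  with assms obtain D where "(G has_derivative (\<lambda>h. scalar_op h o\<^sub>L D)) (at w)"
    unfolding op_holomorphic_on_def by blast
  moreover have "bounded_linear (\<lambda>A. cinner x (blinfun_apply A y))"
    by (rule bounded_linear_compose[OF bounded_linear_cinner blinfun.bounded_linear_left])
  ultimately have "((\<lambda>w. cinner x (G w y)) has_derivative
      (\<lambda>h. cinner x ((scalar_op h o\<^sub>L D) y))) (at w)"
    by (rule bounded_linear.has_derivative[rotated])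
  then have "((\<lambda>w. cinner x (G w y)) has_field_derivative cinner x (D y)) (at w)"
    by (simp add: has_field_derivative_def cinner_cscale_right mult.commute[of _ "cinner x (D y)"])
  then show "\<exists>d. ((\<lambda>w. cinner x (G w y)) has_field_derivative d) (at w)" ..
qed

lemma scalar_op_compose_bound: "norm (scalar_op h o\<^sub>L D) \<le> cmod h * norm D"
proof -
  have "norm (scalar_op h) \<le> cmod h"
    by (rule norm_blinfun_bound) (auto simp: norm_cscale)
  then show ?thesis
    by (meson mult_right_mono norm_blinfun_compose norm_ge_zero order_trans)
qed

lemma bounded_linear_scalar_op_compose: "bounded_linear (\<lambda>h. scalar_op h o\<^sub>L D)"
  by (rule bounded_linear_compose[OF
      bounded_bilinear.bounded_linear_left[OF bounded_bilinear_blinfun_compose]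
      bounded_linear_scalar_op])

section \<open>From Taylor estimates to differentiability in operator norm\<close>

lemma has_derivative_quadratic:
  assumes "bounded_linear f'" "s > 0"
    and "\<And>y. dist y w < s \<Longrightarrow> norm (f y - f w - f' (y - w)) \<le> M * (norm (y - w))\<^sup>2"
  shows "(f has_derivative f') (at w)"
proof (rule has_derivativeI_sandwich[OF \<open>s > 0\<close> assms(1)])
  show "norm (f y - f w - f' (y - w)) / norm (y - w) \<le> M * norm (y - w)"
    if "y \<noteq> w" "dist y w < s" for y
    using assms(3)[OF that(2)] that(1) by (simp add: field_simps power2_eq_square)
  show "((\<lambda>y. M * norm (y - w)) \<longlongrightarrow> 0) (at w)"
    by (auto intro!: tendsto_eq_intros)
qed

text \<open>Both bounds are linear in \<open>M\<close> with factors independent of \<open>f\<close>.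
  Applied to each matrix entry with its own \<open>M\<close>, they therefore carry the decay of a
  kernel over to its derivative and its Taylor remainder.\<close>

lemma cauchy_derivative_bounds:
  assumes "f holomorphic_on ball w (2 * s)" "s > 0"
    and "\<And>y. y \<in> ball w (2 * s) \<Longrightarrow> cmod (f y) \<le> M"
  shows "cmod (deriv f w) \<le> M / s"
    and "dist y w < s \<Longrightarrow> cmod (f y - f w - (y - w) * deriv f w) \<le> 8 * M / s\<^sup>2 * (cmod (y - w))\<^sup>2"
proof -
  have holf: "f holomorphic_on X" if "X \<subseteq> ball w (2 * s)" for X
    using assms(1) that by (rule holomorphic_on_subset)
  have C: "cmod ((deriv ^^ n) f x) \<le> fact n * M / t ^ n"
    if "t > 0" "cball x t \<subseteq> ball w (2 * s)" for n x t
  proof (rule Cauchy_inequality[OF _ _ that(1)])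
    show "f holomorphic_on ball x t" "continuous_on (cball x t) f"
      using that by (auto intro!: holf holomorphic_on_imp_continuous_on)
    show "cmod (f y) \<le> M" if "cmod (x - y) = t" for y
      using \<open>cball x t \<subseteq> _\<close> that by (intro assms(3)) (auto simp: subset_iff dist_norm)
  qed
  have "cball w s \<subseteq> ball w (2 * s)" using \<open>s > 0\<close> by auto
  with C[OF \<open>s > 0\<close> this, of 1] show "cmod (deriv f w) \<le> M / s" by simp
  assume y: "dist y w < s"
  have "cmod ((deriv ^^ 0) f y - (\<Sum>i\<le>1. (deriv ^^ i) f w * (y - w) ^ i / fact i))
      \<le> (8 * M / s\<^sup>2) * cmod (y - w) ^ Suc 1 / fact 1"
  proof (rule complex_Taylor)
    show "convex (ball w s)" "w \<in> ball w s" "y \<in> ball w s"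
      using y \<open>s > 0\<close> by (auto simp: dist_commute)
    fix x assume x: "x \<in> ball w s"
    show "((deriv ^^ i) f has_field_derivative (deriv ^^ Suc i) f x) (at x within ball w s)" for i
    proof -
      have "(deriv ^^ i) f holomorphic_on ball w (2 * s)"
        using assms(1) by (rule holomorphic_higher_deriv) simp
      from holomorphic_derivI[OF this open_ball] x \<open>s > 0\<close>
      show ?thesis by (auto intro: has_field_derivative_at_within)
    qed
    \<comment> \<open>A disc of radius \<open>s / 2\<close> about any point of
      \<open>ball w s\<close> stays in the domain, so Cauchy's estimate bounds the second derivative
      by \<open>2 * M / (s / 2)^2\<close>, which is the constant \<open>8 * M / s^2\<close>.\<close>
    have "cball x (s / 2) \<subseteq> ball w (2 * s)"
    proof
      fix z assume "z \<in> cball x (s / 2)"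
      with x dist_triangle[of w z x] show "z \<in> ball w (2 * s)"
        using \<open>s > 0\<close> by auto
    qed
    from C[OF _ this, of 2] \<open>s > 0\<close>
    show "cmod ((deriv ^^ Suc 1) f x) \<le> 8 * M / s\<^sup>2"
      by (simp add: power_divide numeral_2_eq_2)
  qed
  then show "cmod (f y - f w - (y - w) * deriv f w) \<le> 8 * M / s\<^sup>2 * (cmod (y - w))\<^sup>2"
    by (simp add: algebra_simps power2_eq_square)
qed

text \<open>Under a decay bound uniform in \<open>w\<close>, the entrywise derivatives form a
  decaying kernel, and so do the Taylor remainders, with a constant quadratic in the increment. The
  norm bound for kernel operators then gives the operator derivative.\<close>

lemma op_holomorphic_kernel_op:
  assumes "open U" "0 \<le> r" "r < 1"
    and hol: "\<And>n m. (\<lambda>w. k w n m) holomorphic_on U"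
    and dec: "\<And>w. w \<in> U \<Longrightarrow> decaying r C (k w)"
  shows "(\<lambda>w. kernel_op (k w)) op_holomorphic_on U"
  unfolding op_holomorphic_on_def
proof (intro ballI conjI)
  fix w assume "w \<in> U"
  then show "complex_linear (kernel_op (k w))"
    using complex_linear_kernel_op assms(2,3) dec by blast
  obtain e where "e > 0" "ball w e \<subseteq> U"
    using \<open>open U\<close> \<open>w \<in> U\<close> openE by blast
  define s where "s = e / 2"
  have s: "s > 0" "ball w (2 * s) \<subseteq> U"
    using \<open>e > 0\<close> \<open>ball w e \<subseteq> U\<close> by (auto simp: s_def)
  define b where "b n m = r ^ (nat \<bar>n\<bar> + nat \<bar>m\<bar>)" for n m
  have hol': "(\<lambda>w. k w n m) holomorphic_on ball w (2 * s)" for n m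
    using hol s(2) by (rule holomorphic_on_subset)
  have bound: "cmod (k y n m) \<le> C * b n m" if "y \<in> ball w (2 * s)" for y n m
    using dec s(2) that by (auto simp: decaying_def b_def)
  define k' where "k' n m = deriv (\<lambda>w. k w n m) w" for n m
  have "decaying r (C / s) k'"
    using cauchy_derivative_bounds(1)[OF hol' s(1) bound] by (simp add: decaying_def k'_def b_def)
  note k' = \<open>0 \<le> r\<close> \<open>r < 1\<close> this
  have "((\<lambda>w. kernel_op (k w)) has_derivative (\<lambda>h. scalar_op h o\<^sub>L kernel_op k')) (at w)"
  proof (rule has_derivative_quadratic[OF bounded_linear_scalar_op_compose s(1)])
    fix y assume y: "dist y w < s"
    then have "y \<in> U"
      using s by (auto simp: subset_iff dist_commute)
    note ky = \<open>0 \<le> r\<close> \<open>r < 1\<close> dec[OF \<open>y \<in> U\<close>] and kw = \<open>0 \<le> r\<close> \<open>r < 1\<close> dec[OF \<open>w \<in> U\<close>]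
    define q where "q n m = k y n m - k w n m - (y - w) * k' n m" for n m
    have "decaying r (8 * C / s\<^sup>2 * (cmod (y - w))\<^sup>2) q"
      using cauchy_derivative_bounds(2)[OF hol' s(1) bound y]
      by (auto simp: decaying_def q_def k'_def b_def mult_ac)
    note q = \<open>0 \<le> r\<close> \<open>r < 1\<close> this
    have "kernel_op (k y) - kernel_op (k w) - (scalar_op (y - w) o\<^sub>L kernel_op k') = kernel_op q"
      by (rule eq_by_matrix_entries)
        (simp_all add: complex_linear_intros complex_linear_kernel_op[OF ky]
          complex_linear_kernel_op[OF kw] complex_linear_kernel_op[OF k']
          complex_linear_kernel_op[OF q] matrix_entry_diff matrix_entry_scalar_op
          matrix_entry_kernel_op[OF ky] matrix_entry_kernel_op[OF kw]
          matrix_entry_kernel_op[OF k'] matrix_entry_kernel_op[OF q], simp add: q_def)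
    then show "norm (kernel_op (k y) - kernel_op (k w) - (scalar_op (y - w) o\<^sub>L kernel_op k'))
        \<le> 8 * C / s\<^sup>2 * geo_const r * (norm (y - w))\<^sup>2"
      using norm_kernel_op[OF q] by (simp add: mult_ac)
  qed
  then show "\<exists>D. ((\<lambda>w. kernel_op (k w)) has_derivative (\<lambda>h. scalar_op h o\<^sub>L D)) (at w)" ..
qed

text \<open>The derivative is \<open>- G D G\<close>, by the identity
  \<open>G y - G w = - G y (A y - A w) G w\<close>; the uniform bound on \<open>G\<close> controls
  the remainder.\<close>

lemma op_holomorphic_inverse:
  assumes "open U" and A: "A op_holomorphic_on U"
    and inv: "\<And>w. w \<in> U \<Longrightarrow> A w o\<^sub>L G w = id_blinfun" "\<And>w. w \<in> U \<Longrightarrow> G w o\<^sub>L A w = id_blinfun"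
    and bound: "\<And>w. w \<in> U \<Longrightarrow> norm (G w) \<le> C"
  shows "G op_holomorphic_on U"
  unfolding op_holomorphic_on_def
proof (intro ballI conjI)
  fix w assume "w \<in> U"
  have AG: "A y (G y x) = x" and GA: "G y (A y x) = x" if "y \<in> U" for x y
    using inv that by (metis blinfun_apply_blinfun_compose blinfun_apply_id_blinfun)+
  show linG: "complex_linear (G w)"
    using complex_linear_inverse op_holomorphic_complex_linear[OF A] inv \<open>w \<in> U\<close> by blast
  have diff: "G y - G w = - (G y o\<^sub>L (A y - A w) o\<^sub>L G w)" if "y \<in> U" for y
    by (rule blinfun_eqI)
      (simp add: blinfun.diff_left blinfun.diff_right blinfun.minus_left AG GA \<open>w \<in> U\<close> that)
  obtain D where D: "(A has_derivative (\<lambda>h. scalar_op h o\<^sub>L D)) (at w)"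
    using A \<open>w \<in> U\<close> unfolding op_holomorphic_on_def by blast
  define \<rho> where "\<rho> y = norm (A y - A w - (scalar_op (y - w) o\<^sub>L D)) / norm (y - w)" for y
  have \<rho>: "(\<rho> \<longlongrightarrow> 0) (at w)"
    using D unfolding has_derivative_iff_norm \<rho>_def[abs_def] by blast
  have A_lim: "(A \<longlongrightarrow> A w) (at w)"
    using has_derivative_continuous[OF D] by (simp add: continuous_at)
  have C: "C \<ge> 0" using bound[OF \<open>w \<in> U\<close>] norm_ge_zero order_trans by blast
  have prod3: "norm (X o\<^sub>L Y o\<^sub>L Z) \<le> norm X * norm Y * norm Z" for X Y Z :: "ell2 \<Rightarrow>\<^sub>L ell2"
    by (meson norm_blinfun_compose mult_right_mono norm_ge_zero order_trans)
  obtain e where e: "e > 0" "ball w e \<subseteq> U"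
    using \<open>open U\<close> \<open>w \<in> U\<close> openE by blast
  have "(G has_derivative (\<lambda>h. scalar_op h o\<^sub>L - (G w o\<^sub>L D o\<^sub>L G w))) (at w)"
  proof (rule has_derivativeI_sandwich[OF e(1) bounded_linear_scalar_op_compose])
    show "((\<lambda>y. C^3 * (norm D + \<rho> y) * norm (A y - A w) + C\<^sup>2 * \<rho> y) \<longlongrightarrow> 0) (at w)"
      by (rule tendsto_eq_intros A_lim \<rho> refl | simp)+
    fix y assume y: "y \<noteq> w" "dist y w < e"
    then have "y \<in> U" using e by (auto simp: dist_commute)
    define h where "h = y - w"
    define \<Delta> where "\<Delta> = A y - A w"
    define E where "E = \<Delta> - (scalar_op h o\<^sub>L D)"
    have "h \<noteq> 0" using y by (simp add: h_def)
    have E: "norm E = \<rho> y * norm h"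
      using \<open>h \<noteq> 0\<close> by (simp add: E_def \<Delta>_def h_def \<rho>_def)
    have "norm \<Delta> \<le> norm (scalar_op h o\<^sub>L D) + norm E"
      using norm_triangle_ineq[of "scalar_op h o\<^sub>L D" E] by (simp add: E_def)
    also have "\<dots> \<le> (norm D + \<rho> y) * norm h"
      using scalar_op_compose_bound[of h D] by (simp add: E algebra_simps)
    finally have \<Delta>: "norm \<Delta> \<le> (norm D + \<rho> y) * norm h" .
    have diff: "G y - G w = - (G y o\<^sub>L \<Delta> o\<^sub>L G w)"
      by (rule blinfun_eqI)
        (simp add: \<Delta>_def blinfun.diff_left blinfun.diff_right blinfun.minus_left AG GA
          \<open>w \<in> U\<close> \<open>y \<in> U\<close>)
    have "norm (G y - G w) \<le> C * norm \<Delta> * C"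
      unfolding diff norm_minus_cancel
      by (rule order_trans[OF prod3]) (intro mult_mono bound \<open>w \<in> U\<close> \<open>y \<in> U\<close> C mult_nonneg_nonneg
        norm_ge_zero order_refl)
    then have "norm ((G y - G w) o\<^sub>L \<Delta> o\<^sub>L G w) \<le> (C * norm \<Delta> * C) * norm \<Delta> * C"
      by (intro order_trans[OF prod3] mult_mono bound \<open>w \<in> U\<close> C mult_nonneg_nonneg
        norm_ge_zero order_refl)
    moreover have "norm (G w o\<^sub>L E o\<^sub>L G w) \<le> C * norm E * C"
      by (intro order_trans[OF prod3] mult_mono bound \<open>w \<in> U\<close> C mult_nonneg_nonneg
        norm_ge_zero order_refl)
    \<comment> \<open>Replacing \<open>G y\<close> by \<open>G w + (G y - G w)\<close> in the
      identity leaves two errors: one of second order in \<open>\<Delta>\<close>, and one containing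
      the linearisation error \<open>E\<close> of \<open>A\<close>.\<close>
    moreover have "G y - G w - (scalar_op h o\<^sub>L - (G w o\<^sub>L D o\<^sub>L G w)) =
        - ((G y - G w) o\<^sub>L \<Delta> o\<^sub>L G w) - (G w o\<^sub>L E o\<^sub>L G w)"
      by (subst diff, rule blinfun_eqI) (simp add: E_def blinfun.diff_left blinfun.diff_right
        blinfun.minus_left blinfun.minus_right complex_linearD[OF linG])
    ultimately have "norm (G y - G w - (scalar_op h o\<^sub>L - (G w o\<^sub>L D o\<^sub>L G w)))
        \<le> C^3 * norm \<Delta> * norm \<Delta> + C\<^sup>2 * norm E"
      using norm_triangle_ineq4[of "- ((G y - G w) o\<^sub>L \<Delta> o\<^sub>L G w)" "G w o\<^sub>L E o\<^sub>L G w"]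
      by (simp add: power2_eq_square power3_eq_cube mult_ac)
    also have "\<dots> \<le> C^3 * ((norm D + \<rho> y) * norm h) * norm \<Delta> + C\<^sup>2 * (\<rho> y * norm h)"
      unfolding E by (intro add_mono mult_right_mono mult_left_mono \<Delta> order_refl) (use C in auto)
    also have "\<dots> = (C^3 * (norm D + \<rho> y) * norm \<Delta> + C\<^sup>2 * \<rho> y) * norm h"
      by (simp add: algebra_simps)
    finally show "norm (G y - G w - (scalar_op (y - w) o\<^sub>L - (G w o\<^sub>L D o\<^sub>L G w))) / norm (y - w)
        \<le> C^3 * (norm D + \<rho> y) * norm (A y - A w) + C\<^sup>2 * \<rho> y"
      using \<open>h \<noteq> 0\<close> by (simp add: h_def \<Delta>_def pos_divide_le_eq)
  qed
  then show "\<exists>D. (G has_derivative (\<lambda>h. scalar_op h o\<^sub>L D)) (at w)" ..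
qed

section \<open>Inverses of holomorphic families of compact perturbations\<close>

text \<open>The series of powers of \<open>E\<close>: peeling a factor off on the left shows that
  the sum is a right inverse, peeling it off on the right that it is a left inverse.\<close>

lemma neumann:
  fixes E :: "ell2 \<Rightarrow>\<^sub>L ell2"
  assumes "norm E < 1"
  obtains G where "(id_blinfun - E) o\<^sub>L G = id_blinfun" "G o\<^sub>L (id_blinfun - E) = id_blinfun"
    "norm G \<le> 1 / (1 - norm E)"
proof -
  define P where "P n = ((\<lambda>A. E o\<^sub>L A) ^^ n) id_blinfun" for n
  have P0: "P 0 = id_blinfun" and PS: "P (Suc n) = E o\<^sub>L P n" for n
    by (simp_all add: P_def)
  have PS': "P (Suc n) = P n o\<^sub>L E" for n
  proof (induction n)
    case 0
    show ?case by (rule blinfun_eqI) (simp add: P0 PS)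
  next
    case (Suc n)
    then show ?case by (metis PS blinfun_compose_assoc)
  qed
  have nP: "norm (P n) \<le> norm E ^ n" for n
  proof (induction n)
    case (Suc n)
    then show ?case
      using norm_blinfun_compose[of E "P n"] mult_left_mono[OF Suc, of "norm E"]
      by (simp add: PS)
  qed (simp add: P0 norm_blinfun_id_le)
  have geo: "summable (\<lambda>n. norm E ^ n)"
    using assms by (simp add: summable_geometric)
  have sP: "summable P"
    by (rule summable_comparison_test'[OF geo, of 0]) (simp add: nP)
  define G where "G = suminf P"
  have 1: "G = id_blinfun + (\<Sum>n. P (Suc n))"
    using suminf_split_head[OF sP] by (simp add: G_def P0)
  have 2: "(\<Sum>n. P (Suc n)) = E o\<^sub>L G"
    unfolding PS G_def
    using bounded_linear.suminf[OF bounded_bilinear.bounded_linear_right[OF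
        bounded_bilinear_blinfun_compose] sP] by metis
  have 3: "(\<Sum>n. P (Suc n)) = G o\<^sub>L E"
    unfolding PS' G_def
    using bounded_linear.suminf[OF bounded_bilinear.bounded_linear_left[OF
        bounded_bilinear_blinfun_compose] sP] by metis
  have "norm G \<le> (\<Sum>n. norm E ^ n)"
    unfolding G_def by (rule norm_suminf_le[OF nP geo])
  also have "\<dots> = 1 / (1 - norm E)"
    using assms by (simp add: suminf_geometric)
  finally have 4: "norm G \<le> 1 / (1 - norm E)" .
  have "G - (E o\<^sub>L G) = id_blinfun" "G - (G o\<^sub>L E) = id_blinfun"
    unfolding 2[symmetric] 3[symmetric] using 1 by (metis add_diff_cancel_right')+
  moreover have "id_blinfun o\<^sub>L G = G" "G o\<^sub>L id_blinfun = G"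
    by (rule blinfun_eqI; simp)+
  ultimately show thesis
    using that[OF _ _ 4] by (simp add: blinfun_compose_distribs)
qed

text \<open>A rank one operator compresses \<open>M\<close> to a scalar. This is what closes the
  Sherman-Morrison computation.\<close>

lemma rank_one_sandwich:
  assumes "complex_linear M"
  shows "rank_one f g o\<^sub>L (M o\<^sub>L rank_one f g) = scalar_op (cinner g (M f)) o\<^sub>L rank_one f g"
  by (rule blinfun_eqI)
    (simp add: rank_one.rep_eq complex_linearD[OF assms] cinner_cscale_right)

text \<open>Meromorphic invertibility without denominators: \<open>G / d\<close> is the inverse
  where \<open>d\<close> does not vanish, so \<open>d\<close> and \<open>G\<close> act like a
  determinant and an adjugate. The condition at 0, the point over z = infinity, keeps
  \<open>d\<close> from vanishing identically.\<close>

definition invertible_off_zeros :: "complex set \<Rightarrow> (complex \<Rightarrow> (ell2 \<Rightarrow>\<^sub>L ell2)) \<Rightarrow> bool" where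
  "invertible_off_zeros U A \<longleftrightarrow> (\<forall>w\<in>U. complex_linear (A w)) \<and>
    (\<exists>d G. d holomorphic_on U \<and> d 0 \<noteq> 0 \<and> G op_holomorphic_on U \<and>
      (\<forall>w\<in>U. A w o\<^sub>L G w = scalar_op (d w) \<and> G w o\<^sub>L A w = scalar_op (d w)))"

text \<open>The start of the construction, with \<open>d = 1\<close>. The margin
  \<open>1 / 2\<close> bounds all Neumann inverses by 2, and this uniform bound makes them
  holomorphic.\<close>

lemma invertible_off_zeros_small_perturbation:
  assumes "open U" "E op_holomorphic_on U" "\<And>w. w \<in> U \<Longrightarrow> norm (E w) \<le> 1 / 2"
  shows "invertible_off_zeros U (\<lambda>w. id_blinfun - E w)"
proof -
  have "\<forall>w. \<exists>G. w \<in> U \<longrightarrow> (id_blinfun - E w) o\<^sub>L G = id_blinfun \<and>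
      G o\<^sub>L (id_blinfun - E w) = id_blinfun \<and> norm G \<le> 2"
  proof
    fix w
    show "\<exists>G. w \<in> U \<longrightarrow> (id_blinfun - E w) o\<^sub>L G = id_blinfun \<and>
      G o\<^sub>L (id_blinfun - E w) = id_blinfun \<and> norm G \<le> 2"
    proof (cases "w \<in> U")
      case True
      with assms(3) have n: "norm (E w) \<le> 1 / 2" by blast
      then obtain G where G: "(id_blinfun - E w) o\<^sub>L G = id_blinfun"
        "G o\<^sub>L (id_blinfun - E w) = id_blinfun" "norm G \<le> 1 / (1 - norm (E w))"
        using neumann[of "E w"] by force
      have "1 / (1 - norm (E w)) \<le> 2" using n by (simp add: field_simps)
      with G show ?thesis using order_trans by blast
    qed auto
  qed
  then obtain G where G: "\<And>w. w \<in> U \<Longrightarrow> (id_blinfun - E w) o\<^sub>L G w = id_blinfun"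
    "\<And>w. w \<in> U \<Longrightarrow> G w o\<^sub>L (id_blinfun - E w) = id_blinfun" "\<And>w. w \<in> U \<Longrightarrow> norm (G w) \<le> 2"
    by metis
  have hol: "(\<lambda>w. id_blinfun - E w) op_holomorphic_on U"
    by (intro op_holomorphic_diff op_holomorphic_const complex_linear_id assms)
  have one: "scalar_op 1 = id_blinfun"
    by (rule blinfun_eqI) simp
  show ?thesis
    unfolding invertible_off_zeros_def
    using op_holomorphic_complex_linear[OF hol] op_holomorphic_inverse[OF assms(1) hol G] G(1,2)
    by (intro conjI ballI exI[of _ "\<lambda>_. 1"] exI[of _ G]) (auto simp: one)
qed

text \<open>The Sherman--Morrison formula, cleared of denominators.\<close>

lemma invertible_off_zeros_rank_one_update:
  assumes U: "open U" "0 \<in> U" and A: "invertible_off_zeros U A"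
    and M: "M op_holomorphic_on U" "M 0 = 0"
    and e: "e holomorphic_on U" "e 0 \<noteq> 0"
  shows "invertible_off_zeros U (\<lambda>w. (scalar_op (e w) o\<^sub>L A w) + (rank_one f g o\<^sub>L M w))"
proof -
  from A obtain d G where d: "d holomorphic_on U" "d 0 \<noteq> 0" and G: "G op_holomorphic_on U"
    and AG: "\<And>w. w \<in> U \<Longrightarrow> A w o\<^sub>L G w = scalar_op (d w)"
    and GA: "\<And>w. w \<in> U \<Longrightarrow> G w o\<^sub>L A w = scalar_op (d w)"
    and linA: "\<And>w. w \<in> U \<Longrightarrow> complex_linear (A w)"
    unfolding invertible_off_zeros_def by blast
  define R where "R = rank_one f g"
  define s where "s w = cinner g ((M w o\<^sub>L G w) f)" for w
  \<comment> \<open>Where \<open>e d\<close> is nonzero, \<open>G / (e d)\<close> inverts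
    \<open>e A\<close> and the Sherman-Morrison denominator is \<open>1 + s / (e d)\<close>.
    Multiplying it by \<open>e d\<close> gives \<open>b\<close>, and the updated inverse is
    \<open>Y / (e d b)\<close>.\<close>
  define b where "b w = e w * d w + s w" for w
  define Y where "Y w = (scalar_op (b w) o\<^sub>L G w) - (G w o\<^sub>L (R o\<^sub>L (M w o\<^sub>L G w)))" for w
  have linR: "complex_linear R" by (simp add: R_def complex_linear_rank_one)
  have MG: "(\<lambda>w. M w o\<^sub>L G w) op_holomorphic_on U"
    by (intro op_holomorphic_compose M G)
  have s: "s holomorphic_on U"
    unfolding s_def by (rule op_holomorphic_cinner[OF MG U(1)])
  have b: "b holomorphic_on U"
    unfolding b_def by (intro holomorphic_intros e d s)
  \<comment> \<open>Since \<open>M\<close> vanishes at 0, the update does not change the denominator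
    there: \<open>b 0 = e 0 * d 0\<close>.\<close>
  have "s 0 = 0" by (simp add: s_def M cinner_def)
  then have "e 0 * d 0 * b 0 \<noteq> 0" using d e by (simp add: b_def)
  moreover have "(\<lambda>w. e w * d w * b w) holomorphic_on U"
    by (intro holomorphic_intros e d b)
  moreover have "Y op_holomorphic_on U"
    unfolding Y_def by (intro op_holomorphic_diff op_holomorphic_compose op_holomorphic_scalar_op
        op_holomorphic_const linR b G M U)
  moreover have "complex_linear ((scalar_op (e w) o\<^sub>L A w) + (R o\<^sub>L M w))"
    "((scalar_op (e w) o\<^sub>L A w) + (R o\<^sub>L M w)) o\<^sub>L Y w = scalar_op (e w * d w * b w)"
    "Y w o\<^sub>L ((scalar_op (e w) o\<^sub>L A w) + (R o\<^sub>L M w)) = scalar_op (e w * d w * b w)"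
    if w: "w \<in> U" for w
  proof -
    have linM: "complex_linear (M w)" and linG: "complex_linear (G w)"
      using M G w op_holomorphic_complex_linear by blast+
    show "complex_linear ((scalar_op (e w) o\<^sub>L A w) + (R o\<^sub>L M w))"
      by (intro complex_linear_intros linA linR linM w)
    note lin = complex_linearD[OF linM] complex_linearD[OF linG] complex_linearD[OF linA[OF w]]
      complex_linearD[OF linR]
    have AG': "A w (G w x) = d w *\<^sub>C x" and GA': "G w (A w x) = d w *\<^sub>C x" for x
      using AG[OF w] GA[OF w] by (metis blinfun_apply_blinfun_compose scalar_op_apply)+
    have R: "R (M w (G w (R x))) = s w *\<^sub>C R x" for x
      using arg_cong[OF rank_one_sandwich[OF complex_linear_compose[OF linM linG]],
          of "\<lambda>A. blinfun_apply A x" f g] by (simp add: R_def s_def)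
    show "((scalar_op (e w) o\<^sub>L A w) + (R o\<^sub>L M w)) o\<^sub>L Y w = scalar_op (e w * d w * b w)"
      by (rule blinfun_eqI, rule ell2_eqI)
        (simp add: Y_def b_def blinfun.add_left blinfun.diff_left blinfun.add_right
          blinfun.diff_right lin AG' GA' R, simp add: algebra_simps)
    show "Y w o\<^sub>L ((scalar_op (e w) o\<^sub>L A w) + (R o\<^sub>L M w)) = scalar_op (e w * d w * b w)"
      by (rule blinfun_eqI, rule ell2_eqI)
        (simp add: Y_def b_def blinfun.add_left blinfun.diff_left blinfun.add_right
          blinfun.diff_right lin AG' GA' R, simp add: algebra_simps)
  qed
  ultimately show ?thesis
    unfolding invertible_off_zeros_def R_def by blast
qed

definition coord_proj :: "int set \<Rightarrow> (ell2 \<Rightarrow>\<^sub>L ell2)" where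
  "coord_proj F = (\<Sum>n\<in>F. rank_one (basis_vec n) (basis_vec n))"

lemma complex_linear_sum:
  "(\<And>i. i \<in> F \<Longrightarrow> complex_linear (A i)) \<Longrightarrow> complex_linear (\<Sum>i\<in>F. A i)"
  by (induction F rule: infinite_finite_induct) (auto intro: complex_linear_intros)

lemma complex_linear_coord_proj: "complex_linear (coord_proj F)"
  unfolding coord_proj_def by (intro complex_linear_sum complex_linear_rank_one)

lemma coord_coord_proj:
  "finite F \<Longrightarrow> coord (coord_proj F x) n = (if n \<in> F then coord x n else 0)"
  unfolding coord_proj_def
  by (induction F rule: finite_induct)
    (auto simp: blinfun.add_left rank_one.rep_eq cinner_basis_vec)

text \<open>Split \<open>K T\<close> into \<open>(K - P K) T\<close>, which is small, and
  \<open>P K T\<close> with \<open>P = coord_proj N\<close>. The small part is inverted first, then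
  the rank one coordinate projections making up \<open>P\<close> are added one by one, each
  multiplied by \<open>K T\<close>, which vanishes at 0.\<close>

lemma invertible_off_zeros_compact_perturbation:
  assumes U: "open U" "0 \<in> U" and T: "T op_holomorphic_on U" "T 0 = 0"
    and K: "complex_linear K"
    and N: "finite N" "\<And>w. w \<in> U \<Longrightarrow> norm ((K - (coord_proj N o\<^sub>L K)) o\<^sub>L T w) \<le> 1 / 2"
  shows "invertible_off_zeros U (\<lambda>w. id_blinfun + (K o\<^sub>L T w))"
proof -
  define E where "E w = (- 1) *\<^sub>R ((K - (coord_proj N o\<^sub>L K)) o\<^sub>L T w)" for w
  have E: "E w = scalar_op (-1) o\<^sub>L (K - (coord_proj N o\<^sub>L K)) o\<^sub>L T w" for w
    by (rule blinfun_eqI, rule ell2_eqI) (simp add: E_def blinfun.scaleR_left blinfun.minus_left)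
  have hol: "E op_holomorphic_on U"
    unfolding E by (intro op_holomorphic_compose op_holomorphic_const complex_linear_intros K T
        complex_linear_coord_proj)
  have one: "scalar_op 1 o\<^sub>L A = A" for A
    by (rule blinfun_eqI, rule ell2_eqI) simp
  have "invertible_off_zeros U (\<lambda>w. (id_blinfun - E w) + (coord_proj F o\<^sub>L (K o\<^sub>L T w)))"
    if "finite F" for F
    using that
  proof (induction F rule: finite_induct)
    case empty
    show ?case
      using invertible_off_zeros_small_perturbation[OF U(1) hol] N(2)
      by (simp add: E_def coord_proj_def)
  next
    case (insert n F)
    have "(\<lambda>w. K o\<^sub>L T w) op_holomorphic_on U" "K o\<^sub>L T 0 = 0"
      by (auto intro!: op_holomorphic_compose op_holomorphic_const K T simp: T)
    from invertible_off_zeros_rank_one_update[OF U insert.IH this,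
        of "\<lambda>_. 1" "basis_vec n" "basis_vec n"] insert.hyps
    show ?case
      by (simp add: one coord_proj_def blinfun_compose_distribs algebra_simps)
  qed
  from this[OF N(1)] show ?thesis
    by (simp add: E_def blinfun_compose_distribs blinfun_compose_assoc)
qed

section \<open>The free resolvent\<close>

definition weight :: "real \<Rightarrow> ell2 \<Rightarrow>\<^sub>L ell2" where
  "weight q = Blinfun (\<lambda>x. Abs_ell2 (\<lambda>n. of_real (q ^ nat \<bar>n\<bar>) * coord x n))"

lemma coord_weight:
  assumes "0 \<le> q" "q \<le> 1"
  shows "coord (weight q x) n = of_real (q ^ nat \<bar>n\<bar>) * coord x n"
proof -
  have le: "cmod (of_real (q ^ nat \<bar>n\<bar>) * coord x n) \<le> cmod (coord x n)" for x n
    using assms by (simp add: norm_mult norm_power power_le_one mult_left_le_one_le)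
  have Abs: "coord (Abs_ell2 (\<lambda>n. of_real (q ^ nat \<bar>n\<bar>) * coord x n)) =
      (\<lambda>n. of_real (q ^ nat \<bar>n\<bar>) * coord x n)" for x
  proof -
    have "(\<lambda>n. (cmod (of_real (q ^ nat \<bar>n\<bar>) * coord x n))\<^sup>2) summable_on UNIV"
      by (rule summable_on_comparison_test[OF square_summable_coord[of x]]) (rule power_mono[OF le], simp_all)
    then show ?thesis by (simp add: Abs_ell2_inverse)
  qed
  have "bounded_linear (\<lambda>x. Abs_ell2 (\<lambda>n. of_real (q ^ nat \<bar>n\<bar>) * coord x n))"
  proof (rule bounded_linear_intro[where K = 1])
    show "norm (Abs_ell2 (\<lambda>n. of_real (q ^ nat \<bar>n\<bar>) * coord x n)) \<le> norm x * 1" for x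
      unfolding mult_1_right
      by (rule norm_le_of_coord_le[where b = 1, unfolded mult_1_left]) (simp_all only: Abs le zero_le_one)
  qed (rule ell2_eqI, simp only: coord_add[of "Abs_ell2 _" "Abs_ell2 _"]
      coord_scaleR[of _ "Abs_ell2 _"] Abs, simp add: algebra_simps)+
  then show ?thesis
    by (simp only: weight_def bounded_linear_Blinfun_apply Abs)
qed

lemma complex_linear_weight: "0 \<le> q \<Longrightarrow> q \<le> 1 \<Longrightarrow> complex_linear (weight q)"
  by (rule complex_linearI, rule ell2_eqI) (simp add: coord_weight)

lemma cinner_weight:
  "0 \<le> q \<Longrightarrow> q \<le> 1 \<Longrightarrow> cinner (weight q x) y = cinner x (weight q y)"
  by (simp add: cinner_def coord_weight mult_ac)

lemma matrix_entry_weight_sandwich: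
  assumes "0 \<le> q" "q \<le> 1" "complex_linear A"
  shows "matrix_entry (weight q o\<^sub>L A o\<^sub>L weight q) n m =
    of_real (q ^ (nat \<bar>n\<bar> + nat \<bar>m\<bar>)) * matrix_entry A n m"
proof -
  have "weight q (basis_vec m) = of_real (q ^ nat \<bar>m\<bar>) *\<^sub>C basis_vec m"
    by (rule ell2_eqI) (simp add: coord_weight assms)
  then show ?thesis
    by (simp add: matrix_entry_eq coord_weight complex_linearD assms power_add)
qed

text \<open>Dividing \<open>x\<close> by the weight multiplies the squared moduli by
  \<open>exp (\<delta> * \<bar>n\<bar>)\<close>, so the weighted condition says precisely that the
  quotient is square summable.\<close>

lemma weighted_ell2_weight:
  assumes "x \<in> weighted_ell2 \<delta>" "\<delta> > 0"
  obtains y where "x = weight (exp (- \<delta> / 2)) y"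
proof
  have sq: "(exp (\<delta> / 2) ^ nat \<bar>n\<bar>)\<^sup>2 = exp (\<delta> * of_int \<bar>n\<bar>)" for n :: int
    by (simp flip: exp_of_nat_mult power_mult)
  have "(\<lambda>n. (cmod (of_real (exp (\<delta> / 2) ^ nat \<bar>n\<bar>) * coord x n))\<^sup>2) summable_on UNIV"
    using assms by (simp add: norm_mult power_mult_distrib sq weighted_ell2_def
        flip: of_real_power)
  then have "coord (Abs_ell2 (\<lambda>n. of_real (exp (\<delta> / 2) ^ nat \<bar>n\<bar>) * coord x n)) =
      (\<lambda>n. of_real (exp (\<delta> / 2) ^ nat \<bar>n\<bar>) * coord x n)"
    by (simp add: Abs_ell2_inverse)
  then show "x = weight (exp (- \<delta> / 2))
      (Abs_ell2 (\<lambda>n. of_real (exp (\<delta> / 2) ^ nat \<bar>n\<bar>) * coord x n))"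
    using assms(2) by (intro ell2_eqI)
      (simp add: coord_weight exp_minus field_simps flip: of_real_mult power_mult_distrib)
qed

text \<open>A Joukowski map: the punctured open unit disc covers the complement of [0,4], the unit
  circle lies over [0,4], and 1 and -1 lie over the endpoints 0 and 4.\<close>

definition spectral_param :: "complex \<Rightarrow> complex" where
  "spectral_param w = 2 - w - 1 / w"

text \<open>Existence follows from a factorisation into two operators inverted by Neumann series,
  the entries from guessing each column as a decaying solution of the difference equation. Note the
  sign: \<open>J\<close> inverts \<open>H0 - z\<close>, whereas resolvents here invert
  \<open>z - H0\<close>.\<close>

lemma free_resolvent:
  assumes w: "w \<noteq> 0" "cmod w < 1"
  obtains J where "complex_linear J"
    "(H0 - scalar_op (spectral_param w)) o\<^sub>L J = id_blinfun"
    "J o\<^sub>L (H0 - scalar_op (spectral_param w)) = id_blinfun"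
    "\<And>n m. (1 - w\<^sup>2) * matrix_entry J n m = w ^ Suc (nat \<bar>n - m\<bar>)"
proof -
  define X where "X = H0 - scalar_op (spectral_param w)"
  have linX: "complex_linear X"
    by (simp add: X_def complex_linear_intros complex_linear_H0)
  have bl: "bounded_linear (shift k)" for k
    by (rule bounded_linear_intro[where K = 1]) (auto intro!: ell2_eqI simp: norm_shift)
  define E where "E k = scalar_op w o\<^sub>L Blinfun (shift k)" for k
  have E: "coord (E k x) n = w * coord x (n + k)" for k x n
    by (simp add: E_def bounded_linear_Blinfun_apply[OF bl])
  have "norm (E k) \<le> cmod w" for k
    by (rule norm_blinfun_bound)
      (auto simp: E_def bounded_linear_Blinfun_apply[OF bl] norm_cscale norm_shift)
  then have "norm (E k) < 1" for k
    using w le_less_trans by blast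
  then have "\<exists>G. (id_blinfun - E k) o\<^sub>L G = id_blinfun \<and> G o\<^sub>L (id_blinfun - E k) = id_blinfun" for k
    using neumann[of "E k"] by metis
  then obtain G where G: "\<And>k. (id_blinfun - E k) o\<^sub>L G k = id_blinfun"
    "\<And>k. G k o\<^sub>L (id_blinfun - E k) = id_blinfun"
    by metis
  have EG: "G k x - E k (G k x) = x" and GE: "G k (x - E k x) = x" for k x
    using arg_cong[OF G(1)[of k], of "\<lambda>A. blinfun_apply A x"]
      arg_cong[OF G(2)[of k], of "\<lambda>A. blinfun_apply A x"]
    by (simp_all add: blinfun.diff_left)
  have linG: "G k (c *\<^sub>C x) = c *\<^sub>C G k x" for k c x
  proof (rule complex_linearD, rule complex_linear_inverse[OF _ G(1) G(2)])
    show "complex_linear (id_blinfun - E k)"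
      by (rule complex_linearI, rule ell2_eqI) (simp add: blinfun.diff_left E algebra_simps)
  qed
  text \<open>\<open>H\<^sub>0 - z = w\<^sup>-\<^sup>1 (1 - w S) (1 - w S\<^sup>-\<^sup>1)\<close> for the bilateral shift \<open>S\<close>.\<close>
  have fac: "X x = (1 / w) *\<^sub>C ((x - E (-1) x) - E 1 (x - E (-1) x))" for x
    using w by (intro ell2_eqI) (simp add: X_def blinfun.diff_left E coord_H0 spectral_param_def
        field_simps power2_eq_square)
  define J where "J = scalar_op w o\<^sub>L (G (-1) o\<^sub>L G 1)"
  have XJ: "X (J x) = x" for x
  proof -
    have "X (J x) = w *\<^sub>C X (G (-1) (G 1 x))"
      by (simp add: J_def complex_linearD[OF linX])
    then show ?thesis using w by (simp add: fac EG)
  qed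
  have JX: "J (X x) = x" for x
    using w by (simp add: J_def fac linG GE)
  have J: "X o\<^sub>L J = id_blinfun" "J o\<^sub>L X = id_blinfun"
    by (rule blinfun_eqI; simp add: XJ JX)+
  have w2: "1 - w\<^sup>2 \<noteq> 0"
  proof
    assume "1 - w\<^sup>2 = 0"
    then have "(cmod w)\<^sup>2 = 1" by (metis eq_iff_diff_eq_0 norm_one norm_power)
    then show False using w norm_ge_zero[of w] by (simp add: power2_eq_1_iff)
  qed
  have "matrix_entry J n m = w ^ Suc (nat \<bar>n - m\<bar>) / (1 - w\<^sup>2)" for n m
  proof -
    \<comment> \<open>The candidate for column \<open>m\<close>: if
      \<open>X h = basis_vec m\<close>, then \<open>J\<close> sends \<open>basis_vec m\<close> to
      \<open>h\<close>.\<close>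
    define h where "h = (w / (1 - w\<^sup>2)) *\<^sub>C shift (- m) (geo_vec w)"
    have "X h = basis_vec m"
    proof (rule ell2_eqI)
      fix n
      define j where "j = n - m"
      define v where "v = 1 / w"
      define c where "c = w / (1 - w\<^sup>2)"
      have h: "coord h i = c * w ^ nat \<bar>i - m\<bar>" for i
        using w by (simp add: h_def c_def coord_geo_vec)
      have "coord (X h) n = c * ((w + v) * w ^ nat \<bar>j\<bar> - w ^ nat \<bar>j + 1\<bar> - w ^ nat \<bar>j - 1\<bar>)"
        unfolding X_def spectral_param_def v_def[symmetric]
        by (simp add: blinfun.diff_left coord_H0 h j_def algebra_simps)
      moreover have "(1 - w\<^sup>2) * c = w" using w2 by (simp add: c_def)
      ultimately have "(1 - w\<^sup>2) * coord (X h) n =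
          w * ((w + 1 / w) * w ^ nat \<bar>j\<bar> - w ^ nat \<bar>j + 1\<bar> - w ^ nat \<bar>j - 1\<bar>)"
        unfolding v_def by (metis mult.assoc)
      \<comment> \<open>Off the diagonal, \<open>w\<close> and \<open>1 / w\<close> produce exactly
        the two neighbouring powers. At \<open>j = 0\<close> both neighbours equal \<open>w\<close>,
        which leaves \<open>w * (1 / w - w)\<close>.\<close>
      also have "\<dots> = (1 - w\<^sup>2) * (if j = 0 then 1 else 0)"
      proof -
        consider "j = 0" | "j > 0" | "j < 0" by linarith
        then show ?thesis
        proof cases
          case 1
          with w show ?thesis by (simp add: field_simps power2_eq_square)
        next
          case 2
          then obtain i where "j = int (Suc i)" by (metis pos_int_cases Suc_pred)
          then have "nat \<bar>j\<bar> = Suc i" "nat \<bar>j + 1\<bar> = Suc (Suc i)" "nat \<bar>j - 1\<bar> = i" "j \<noteq> 0" by auto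
          with w show ?thesis by (simp add: field_simps)
        next
          case 3
          then obtain i where "j = - int (Suc i)" by (metis neg_int_cases Suc_pred)
          then have "nat \<bar>j\<bar> = Suc i" "nat \<bar>j - 1\<bar> = Suc (Suc i)" "nat \<bar>j + 1\<bar> = i" "j \<noteq> 0" by auto
          with w show ?thesis by (simp add: field_simps)
        qed
      qed
      finally show "coord (X h) n = coord (basis_vec m) n"
        using w2 by (auto simp: j_def)
    qed
    then have "J (basis_vec m) = h" by (metis JX)
    then show ?thesis using w by (simp add: matrix_entry_eq h_def coord_geo_vec)
  qed
  then show thesis
    using that[of J] J w2 complex_linear_inverse[OF linX J] by (simp add: X_def)
qed

section \<open>Continuation of the weighted free resolvent\<close>

text \<open>The polynomial \<open>(w^(k+1) - w^i) / (1 - w\<^sup>2)\<close>, where \<open>i \<in> {1, 2}\<close> has the parity of \<open>k + 1\<close>.\<close>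

fun regular_part :: "nat \<Rightarrow> complex \<Rightarrow> complex" where
  "regular_part 0 w = 0"
| "regular_part (Suc 0) w = 0"
| "regular_part (Suc (Suc k)) w = w\<^sup>2 * regular_part k w - (if even k then w else w\<^sup>2)"

lemma regular_part_eq:
  "(1 - w\<^sup>2) * regular_part k w = w ^ Suc k - (if even k then w else w\<^sup>2)"
proof (induction k w rule: regular_part.induct)
  case (3 k w)
  have "(1 - w\<^sup>2) * regular_part (Suc (Suc k)) w =
      w\<^sup>2 * ((1 - w\<^sup>2) * regular_part k w) - (1 - w\<^sup>2) * (if even k then w else w\<^sup>2)"
    by (simp add: algebra_simps)
  also have "\<dots> = w ^ Suc (Suc (Suc k)) - (if even k then w else w\<^sup>2)"
    unfolding 3 by (simp add: algebra_simps power2_eq_square)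
  finally show ?case by simp
qed (simp_all add: power2_eq_square)

lemma regular_part_0: "regular_part k 0 = 0"
  by (induction k "0 :: complex" rule: regular_part.induct) auto

lemma holomorphic_regular_part: "regular_part k holomorphic_on U"
proof (induction k rule: induct_nat_012)
  case 0
  show ?case by (simp cong: holomorphic_cong)
next
  case 1
  show ?case by (simp cong: holomorphic_cong)
next
  case (ge2 k)
  then show ?case
    unfolding regular_part.simps by (cases "even k") (auto intro!: holomorphic_intros)
qed

text \<open>The right-hand side solves \<open>b (k + 2) = \<rho>^2 * b k + \<rho>^2\<close> with
  \<open>b 0 = 0\<close>, a majorant of the recursion. No division by \<open>1 - w^2\<close> occurs,
  so the bound is uniform near 1 and -1.\<close>

lemma norm_regular_part_le:
  assumes "cmod w \<le> \<rho>" "\<rho> > 1"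
  shows "cmod (regular_part k w) \<le> \<rho>\<^sup>2 / (\<rho>\<^sup>2 - 1) * (\<rho> ^ k - 1)"
  using assms(1)
proof (induction k w rule: regular_part.induct)
  case (3 k w)
  have \<rho>: "\<rho>\<^sup>2 - 1 > 0" "\<rho> \<le> \<rho>\<^sup>2" using assms(2) one_less_power[of \<rho> 2] by (auto simp: power2_eq_square)
  have w2: "(cmod w)\<^sup>2 \<le> \<rho>\<^sup>2" using 3 by (intro power_mono) auto
  have "cmod (regular_part (Suc (Suc k)) w) \<le>
      (cmod w)\<^sup>2 * cmod (regular_part k w) + cmod (if even k then w else w\<^sup>2)"
    using norm_triangle_ineq4[of "w\<^sup>2 * regular_part k w"]
    by (simp add: norm_mult norm_power)
  also have "\<dots> \<le> \<rho>\<^sup>2 * (\<rho>\<^sup>2 / (\<rho>\<^sup>2 - 1) * (\<rho> ^ k - 1)) + \<rho>\<^sup>2"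
    using 3 w2 \<rho>(2) by (intro add_mono mult_mono) (auto simp: norm_power)
  also have "\<dots> = \<rho>\<^sup>2 / (\<rho>\<^sup>2 - 1) * (\<rho> ^ Suc (Suc k) - 1)"
    using \<rho> by (simp add: field_simps power2_eq_square)
  finally show ?case .
qed (use assms(2) in auto)

section \<open>Splitting the weighted free kernel into regular and singular parts\<close>

definition regular_kernel :: "real \<Rightarrow> complex \<Rightarrow> int \<Rightarrow> int \<Rightarrow> complex" where
  "regular_kernel q w n m =
    of_real (q ^ (nat \<bar>n\<bar> + nat \<bar>m\<bar>)) * regular_part (nat \<bar>n - m\<bar>) w"

text \<open>What \<open>regular_part\<close> leaves over, before division by \<open>1 - w^2\<close>.
  After that division the two scalar factors are \<open>w / (2 * (1 - w))\<close> and
  \<open>w / (2 * (1 + w))\<close>, so each rank one term carries the pole at one endpoint of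
  [0,4].\<close>

definition singular_part :: "real \<Rightarrow> complex \<Rightarrow> ell2 \<Rightarrow>\<^sub>L ell2" where
  "singular_part q w =
    (scalar_op ((w + w\<^sup>2) / 2) o\<^sub>L rank_one (geo_vec (of_real q)) (geo_vec (of_real q))) +
    (scalar_op ((w - w\<^sup>2) / 2) o\<^sub>L rank_one (geo_vec (- of_real q)) (geo_vec (- of_real q)))"

lemma matrix_entry_singular_part:
  assumes "0 \<le> q" "q < 1"
  shows "matrix_entry (singular_part q w) n m =
    of_real (q ^ (nat \<bar>n\<bar> + nat \<bar>m\<bar>)) * (if even (n - m) then w else w\<^sup>2)"
proof -
  have neg: "(- complex_of_real q) ^ k = (-1) ^ k * of_real q ^ k" for k
    by (rule power_minus)
  \<comment> \<open>The alternating signs of \<open>geo_vec (- q)\<close> turn the sum of the two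
    scalar factors into their difference for odd \<open>n - m\<close>, which selects
    \<open>w\<close> or \<open>w^2\<close> by parity.\<close>
  have "even (nat \<bar>n\<bar> + nat \<bar>m\<bar>) \<longleftrightarrow> even (n - m)"
    by (simp add: even_nat_iff)
  then have par: "(- 1) ^ nat \<bar>n\<bar> * (- 1) ^ nat \<bar>m\<bar> = (if even (n - m) then 1 else - 1 :: complex)"
    by (simp flip: power_add)
  have "matrix_entry (singular_part q w) n m =
      (w + w\<^sup>2) / 2 * of_real (q ^ (nat \<bar>n\<bar> + nat \<bar>m\<bar>)) +
      (w - w\<^sup>2) / 2 * (((- 1) ^ nat \<bar>n\<bar> * (- 1) ^ nat \<bar>m\<bar>) * of_real (q ^ (nat \<bar>n\<bar> + nat \<bar>m\<bar>)))"
    using assms by (simp add: singular_part_def matrix_entry_add matrix_entry_scalar_op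
        matrix_entry_rank_one coord_geo_vec neg power_add)
  also have "\<dots> = of_real (q ^ (nat \<bar>n\<bar> + nat \<bar>m\<bar>)) * (if even (n - m) then w else w\<^sup>2)"
    unfolding par by (simp add: field_simps)
  finally show ?thesis .
qed

text \<open>The condition \<open>q * \<rho> < 1\<close> lets the weights absorb the growth of powers
  of \<open>w\<close> on a disc whose radius exceeds 1, so the continuation crosses the unit
  circle.\<close>

locale weights =
  fixes q \<rho> :: real
  assumes q: "0 < q" "q < 1" and \<rho>: "1 < \<rho>" "q * \<rho> < 1"
begin

abbreviation "U \<equiv> ball (0 :: complex) \<rho>"

abbreviation "c\<rho> \<equiv> \<rho>\<^sup>2 / (\<rho>\<^sup>2 - 1)"

lemma c\<rho>_pos: "c\<rho> > 0"
  using \<rho> by (simp add: power_less_one_iff one_less_power)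

lemma q\<rho>: "0 \<le> q * \<rho>" "q * \<rho> < 1"
  using q \<rho> by auto

text \<open>Since \<open>\<bar>n - m\<bar> \<le> \<bar>n\<bar> + \<bar>m\<bar>\<close>, growth like
  \<open>\<rho> ^ \<bar>n - m\<bar>\<close> costs at most one factor \<open>\<rho>\<close> for each
  factor \<open>q\<close> of the weights.\<close>

lemma decaying_regular_kernel:
  assumes "w \<in> U"
  shows "decaying (q * \<rho>) c\<rho> (regular_kernel q w)"
  unfolding decaying_def
proof (intro allI)
  fix n m :: int
  have "cmod (regular_part (nat \<bar>n - m\<bar>) w) \<le> c\<rho> * (\<rho> ^ nat \<bar>n - m\<bar> - 1)"
    using assms \<rho> by (intro norm_regular_part_le) auto
  also have "\<dots> \<le> c\<rho> * \<rho> ^ (nat \<bar>n\<bar> + nat \<bar>m\<bar>)"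
  proof (intro mult_left_mono)
    have "\<rho> ^ nat \<bar>n - m\<bar> \<le> \<rho> ^ (nat \<bar>n\<bar> + nat \<bar>m\<bar>)"
      using \<rho> by (intro power_increasing) auto
    then show "\<rho> ^ nat \<bar>n - m\<bar> - 1 \<le> \<rho> ^ (nat \<bar>n\<bar> + nat \<bar>m\<bar>)" by simp
  qed (use c\<rho>_pos in simp)
  finally have "q ^ (nat \<bar>n\<bar> + nat \<bar>m\<bar>) * cmod (regular_part (nat \<bar>n - m\<bar>) w) \<le>
      q ^ (nat \<bar>n\<bar> + nat \<bar>m\<bar>) * (c\<rho> * \<rho> ^ (nat \<bar>n\<bar> + nat \<bar>m\<bar>))"
    using q by (intro mult_left_mono) auto
  then show "cmod (regular_kernel q w n m) \<le> c\<rho> * (q * \<rho>) ^ (nat \<bar>n\<bar> + nat \<bar>m\<bar>)"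
    using q by (simp add: regular_kernel_def norm_mult norm_power power_mult_distrib mult_ac)
qed

lemma op_holomorphic_regular: "(\<lambda>w. kernel_op (regular_kernel q w)) op_holomorphic_on U"
  by (rule op_holomorphic_kernel_op[OF open_ball q\<rho> _ decaying_regular_kernel])
    (auto simp: regular_kernel_def intro!: holomorphic_intros holomorphic_regular_part)

text \<open>The family \<open>(1 - w^2) W (H0 - z)^(-1) W\<close>, written so that it makes sense on
  all of \<open>U\<close>; the factor clears the poles at 1 and -1.\<close>

definition weighted_free :: "complex \<Rightarrow> ell2 \<Rightarrow>\<^sub>L ell2" where
  "weighted_free w = (scalar_op (1 - w\<^sup>2) o\<^sub>L kernel_op (regular_kernel q w)) + singular_part q w"

lemma op_holomorphic_weighted_free: "weighted_free op_holomorphic_on U"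
  unfolding weighted_free_def[abs_def] singular_part_def
  by (intro op_holomorphic_add op_holomorphic_compose op_holomorphic_scalar_op
      op_holomorphic_regular op_holomorphic_const complex_linear_rank_one open_ball)
    (auto intro!: holomorphic_intros)

lemma weighted_free_resolvent:
  assumes "w \<noteq> 0" "cmod w < 1" "complex_linear J"
    and J: "\<And>n m. (1 - w\<^sup>2) * matrix_entry J n m = w ^ Suc (nat \<bar>n - m\<bar>)"
  shows "scalar_op (1 - w\<^sup>2) o\<^sub>L (weight q o\<^sub>L J o\<^sub>L weight q) = weighted_free w"
proof (rule eq_by_matrix_entries)
  have w: "w \<in> U" using assms \<rho> by auto
  note k = q\<rho> decaying_regular_kernel[OF w]
  show "complex_linear (weighted_free w)"
    using op_holomorphic_weighted_free w by (rule op_holomorphic_complex_linear)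
  show "complex_linear (scalar_op (1 - w\<^sup>2) o\<^sub>L (weight q o\<^sub>L J o\<^sub>L weight q))"
    using q by (intro complex_linear_intros complex_linear_weight assms) auto
  fix n m :: int
  define Q where "Q = complex_of_real (q ^ (nat \<bar>n\<bar> + nat \<bar>m\<bar>))"
  have "matrix_entry (scalar_op (1 - w\<^sup>2) o\<^sub>L (weight q o\<^sub>L J o\<^sub>L weight q)) n m =
      Q * ((1 - w\<^sup>2) * matrix_entry J n m)"
    using q by (simp add: matrix_entry_scalar_op matrix_entry_weight_sandwich assms(3) Q_def)
  also have "\<dots> = Q * ((1 - w\<^sup>2) * regular_part (nat \<bar>n - m\<bar>) w + (if even (n - m) then w else w\<^sup>2))"
    unfolding J regular_part_eq by (auto simp: even_nat_iff)
  also have "\<dots> = matrix_entry (weighted_free w) n m"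
    using q by (simp add: weighted_free_def matrix_entry_add matrix_entry_scalar_op
        matrix_entry_singular_part matrix_entry_kernel_op[OF k] regular_kernel_def Q_def
        algebra_simps)
  finally show "matrix_entry (scalar_op (1 - w\<^sup>2) o\<^sub>L (weight q o\<^sub>L J o\<^sub>L weight q)) n m =
      matrix_entry (weighted_free w) n m" .
qed

text \<open>With \<open>s = sqrt q\<close>, half of the decay is traded for smallness: on the rows
  beyond \<open>j\<close> one factor \<open>s ^ (\<bar>n\<bar> + \<bar>m\<bar>)\<close> is at most
  \<open>s ^ j\<close>, and the other still bounds the operator.\<close>

lemma coord_proj_approximates:
  assumes k: "decaying q C k" and "\<epsilon> > 0"
  obtains N where "finite N" "norm (kernel_op k - (coord_proj N o\<^sub>L kernel_op k)) \<le> \<epsilon>"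
proof -
  define s where "s = sqrt q"
  have s: "0 \<le> s" "s < 1" "s\<^sup>2 = q" using q by (auto simp: s_def)
  have C: "C \<ge> 0" using decaying_nonneg[OF _ _ k] q by simp
  have gc: "0 \<le> geo_const s"
    unfolding geo_const_def by (intro mult_nonneg_nonneg infsum_nonneg) (use s in auto)
  have "(\<lambda>j. s ^ j * (C * geo_const s)) \<longlonglongrightarrow> 0"
    using s by (intro tendsto_mult_left_zero LIMSEQ_power_zero) auto
  then have "\<forall>\<^sub>F j in sequentially. s ^ j * (C * geo_const s) < \<epsilon>"
    using \<open>\<epsilon> > 0\<close> by (rule order_tendstoD)
  then obtain j where j: "s ^ j * (C * geo_const s) < \<epsilon>"
    using eventually_happens by fastforce
  define N where "N = {- int j..int j}"
  have kq: "0 \<le> q" "q < 1" using q by auto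
  define k' where "k' n m = (if n \<in> N then 0 else k n m)" for n m
  have "decaying s (C * s ^ j) k'"
    unfolding decaying_def
  proof (intro allI)
    fix n m
    show "cmod (k' n m) \<le> C * s ^ j * s ^ (nat \<bar>n\<bar> + nat \<bar>m\<bar>)"
    proof (cases "n \<in> N")
      case False
      define a where "a = nat \<bar>n\<bar> + nat \<bar>m\<bar>"
      have "j \<le> a" using False by (auto simp: N_def a_def)
      then have "s ^ a \<le> s ^ j" using s by (intro power_decreasing) auto
      have "cmod (k' n m) \<le> C * q ^ a"
        using k False by (simp add: decaying_def k'_def a_def)
      also have "\<dots> = C * s ^ a * s ^ a"
        by (simp flip: s(3) power_mult power_add add: mult_2)
      also have "\<dots> \<le> C * s ^ j * s ^ a"
        using \<open>s ^ a \<le> s ^ j\<close> s C by (intro mult_right_mono mult_left_mono) auto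
      finally show ?thesis by (simp add: a_def)
    qed (use C s in \<open>simp add: k'_def\<close>)
  qed
  note k' = s(1,2) this
  have fin: "finite N" by (simp add: N_def)
  have "kernel_op k - (coord_proj N o\<^sub>L kernel_op k) = kernel_op k'"
  proof (rule eq_by_matrix_entries)
    show "matrix_entry (kernel_op k - (coord_proj N o\<^sub>L kernel_op k)) n m =
        matrix_entry (kernel_op k') n m" for n m
      unfolding matrix_entry_diff matrix_entry_kernel_op[OF kq k] matrix_entry_kernel_op[OF k']
      using matrix_entry_kernel_op[OF kq k, of n m]
      by (simp add: matrix_entry_eq coord_coord_proj[OF fin] k'_def)
  qed (intro complex_linear_intros complex_linear_coord_proj complex_linear_kernel_op[OF kq k]
      complex_linear_kernel_op[OF k'])+
  then have "norm (kernel_op k - (coord_proj N o\<^sub>L kernel_op k)) \<le> \<epsilon>"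
    using norm_kernel_op[OF k'] j by (simp add: mult_ac)
  with fin show thesis by (rule that)
qed

text \<open>Write the family as \<open>(1 - w^2) (1 + K T)\<close>, with \<open>T\<close> the
  regular part, plus two rank one terms. The first update multiplies by \<open>e = 1 - w^2\<close>,
  the second uses \<open>e = 1\<close>, so the poles never enter the compactness argument.\<close>

lemma invertible_off_zeros_weighted_free:
  assumes k: "decaying q C k"
  shows "invertible_off_zeros U
    (\<lambda>w. scalar_op (1 - w\<^sup>2) + (kernel_op k o\<^sub>L weighted_free w))"
proof -
  define K where "K = kernel_op k"
  define T where "T w = kernel_op (regular_kernel q w)" for w
  have kq: "0 \<le> q" "q < 1" using q by auto
  have linK: "complex_linear K"
    unfolding K_def by (rule complex_linear_kernel_op[OF kq k])
  have U: "open U" "0 \<in> U" using \<rho> by auto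
  have T: "T op_holomorphic_on U"
    unfolding T_def[abs_def] by (rule op_holomorphic_regular)
  have "regular_kernel q 0 = (\<lambda>n m. 0)"
    by (simp add: regular_kernel_def regular_part_0 fun_eq_iff)
  then have T0: "T 0 = 0"
    unfolding T_def
    by (intro blinfun_eqI ell2_eqI, subst coord_kernel_op[OF q\<rho> decaying_regular_kernel[OF U(2)]])
      simp
  define b where "b = c\<rho> * geo_const (q * \<rho>)"
  have b: "norm (T w) \<le> b" if "w \<in> U" for w
    unfolding T_def b_def by (rule norm_kernel_op[OF q\<rho> decaying_regular_kernel[OF that]])
  have "b \<ge> 0" using b[OF U(2)] norm_ge_zero order_trans by blast
  \<comment> \<open>Using \<open>b + 1\<close> instead of \<open>b\<close> covers the case
    \<open>b = 0\<close>.\<close>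
  then have "1 / (2 * (b + 1)) > 0" by simp
  then obtain N where N: "finite N" "norm (K - (coord_proj N o\<^sub>L K)) \<le> 1 / (2 * (b + 1))"
    unfolding K_def by (rule coord_proj_approximates[OF k])
  have "norm ((K - (coord_proj N o\<^sub>L K)) o\<^sub>L T w) \<le> 1 / 2" if "w \<in> U" for w
  proof -
    have "norm ((K - (coord_proj N o\<^sub>L K)) o\<^sub>L T w) \<le> norm (K - (coord_proj N o\<^sub>L K)) * norm (T w)"
      by (rule norm_blinfun_compose)
    also have "\<dots> \<le> 1 / (2 * (b + 1)) * b"
      using \<open>b \<ge> 0\<close> by (intro mult_mono N b that) auto
    also have "\<dots> \<le> 1 / 2" using \<open>b \<ge> 0\<close> by (simp add: field_simps)
    finally show ?thesis .
  qed
  from invertible_off_zeros_compact_perturbation[OF U T T0 linK N(1) this]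
  have 1: "invertible_off_zeros U (\<lambda>w. id_blinfun + (K o\<^sub>L T w))" .
  \<comment> \<open>The scalar is moved to the right of the rank one operator, so that it can serve
    as the factor vanishing at 0 in the update.\<close>
  have rank_one: "rank_one (K u) u o\<^sub>L scalar_op c = K o\<^sub>L (scalar_op c o\<^sub>L rank_one u u)" for u c
    by (rule blinfun_eqI)
      (simp add: rank_one.rep_eq cinner_cscale_right complex_linearD[OF linK])
  have M: "(\<lambda>w. scalar_op ((w + w\<^sup>2) / 2)) op_holomorphic_on U"
    "(\<lambda>w. scalar_op ((w - w\<^sup>2) / 2)) op_holomorphic_on U"
    by (auto intro!: op_holomorphic_scalar_op holomorphic_intros)
  have zero: "scalar_op 0 = 0" and one: "scalar_op 1 o\<^sub>L A = A" for A
    by (rule blinfun_eqI, rule ell2_eqI, simp)+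
  have e: "(\<lambda>w. 1 - w\<^sup>2) holomorphic_on U" "(1 - 0\<^sup>2 :: complex) \<noteq> 0"
    by (auto intro!: holomorphic_intros)
  have "invertible_off_zeros U (\<lambda>w. (scalar_op (1 - w\<^sup>2) o\<^sub>L (id_blinfun + (K o\<^sub>L T w))) +
      (rank_one (K (geo_vec (of_real q))) (geo_vec (of_real q)) o\<^sub>L scalar_op ((w + w\<^sup>2) / 2)))"
    by (rule invertible_off_zeros_rank_one_update[OF U 1 M(1) _ e]) (simp add: zero)
  from invertible_off_zeros_rank_one_update[OF U this M(2), of "\<lambda>_. 1"]
  have "invertible_off_zeros U (\<lambda>w. (scalar_op (1 - w\<^sup>2) o\<^sub>L (id_blinfun + (K o\<^sub>L T w))) +
      (rank_one (K (geo_vec (of_real q))) (geo_vec (of_real q)) o\<^sub>L scalar_op ((w + w\<^sup>2) / 2)) +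
      (rank_one (K (geo_vec (- of_real q))) (geo_vec (- of_real q)) o\<^sub>L scalar_op ((w - w\<^sup>2) / 2)))"
    by (simp add: zero one)
  moreover have "(scalar_op (1 - w\<^sup>2) o\<^sub>L (id_blinfun + (K o\<^sub>L T w))) +
      (rank_one (K (geo_vec (of_real q))) (geo_vec (of_real q)) o\<^sub>L scalar_op ((w + w\<^sup>2) / 2)) +
      (rank_one (K (geo_vec (- of_real q))) (geo_vec (- of_real q)) o\<^sub>L scalar_op ((w - w\<^sup>2) / 2)) =
      scalar_op (1 - w\<^sup>2) + (K o\<^sub>L weighted_free w)" for w
  proof -
    have "scalar_op (1 - w\<^sup>2) o\<^sub>L id_blinfun = scalar_op (1 - w\<^sup>2)"
      by (rule blinfun_eqI) simp
    then show ?thesis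
      unfolding rank_one weighted_free_def singular_part_def T_def
      by (simp add: blinfun_compose_distribs complex_linear_commute[OF linK])
  qed
  ultimately show ?thesis by (simp add: K_def)
qed

end

section \<open>The essential spectrum\<close>

lemma spectral_param_unit_circle:
  assumes "cmod w = 1"
  shows "spectral_param w = of_real (2 - 2 * Re w)" "2 - 2 * Re w \<in> {0..4}"
proof -
  have "w * cnj w = 1" using assms by (metis complex_norm_square of_real_1 one_power2)
  then have "1 / w = cnj w" using assms by (intro divide_eq_eq[THEN iffD2]) (auto simp: mult.commute)
  then show "spectral_param w = of_real (2 - 2 * Re w)"
    by (simp add: spectral_param_def complex_eq_iff)
  show "2 - 2 * Re w \<in> {0..4}"
    using abs_Re_le_cmod[of w] assms by auto
qed

text \<open>The equation for \<open>w\<close> is quadratic with roots \<open>u\<close> and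
  \<open>1 / u\<close>. One of them lies inside the disc unless both are on the circle, and then
  \<open>z\<close> is in [0,4].\<close>

lemma spectral_param_surj:
  assumes "z \<notin> of_real ` {0..4}"
  obtains w where "w \<noteq> 0" "cmod w < 1" "spectral_param w = z"
proof -
  define u where "u = ((2 - z) + csqrt ((2 - z)\<^sup>2 - 4)) / 2"
  have "2 * u = (2 - z) + csqrt ((2 - z)\<^sup>2 - 4)" by (simp add: u_def)
  then have "(2 * u - (2 - z))\<^sup>2 = (2 - z)\<^sup>2 - 4" by simp
  then have "4 * (u * u + 1) = 4 * ((2 - z) * u)" by (simp add: power2_eq_square algebra_simps)
  then have "u * u + 1 = (2 - z) * u" by (simp only: mult_cancel_left) simp
  moreover from this have "u \<noteq> 0" by auto
  ultimately have "u + 1 / u = 2 - z"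
    by (metis add_divide_distrib nonzero_mult_div_cancel_right)
  with \<open>u \<noteq> 0\<close> have u: "u \<noteq> 0" "spectral_param u = z" "spectral_param (1 / u) = z"
    unfolding spectral_param_def by (auto simp: algebra_simps)
  consider "cmod u < 1" | "cmod u > 1" | "cmod u = 1" by linarith
  then show thesis
  proof cases
    case 1
    with u that show thesis by blast
  next
    case 2
    with u that[of "1 / u"] show thesis by (simp add: norm_divide)
  next
    case 3
    then have "z \<in> of_real ` {0..4}"
      using spectral_param_unit_circle[of u] u(2) by (metis image_eqI)
    with assms show thesis by contradiction
  qed
qed

text \<open>A Woodbury formula: the hypotheses on \<open>B\<close> say that it is a right and a left
  inverse of \<open>1 + K W J W\<close>, and \<open>Q\<close> is the resulting inverse of
  \<open>X + W K W\<close>.\<close>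

lemma resolvent_identity:
  fixes X J B K W V :: "ell2 \<Rightarrow>\<^sub>L ell2"
  assumes X: "X o\<^sub>L J = id_blinfun" "J o\<^sub>L X = id_blinfun"
    and B: "B + (K o\<^sub>L W o\<^sub>L J o\<^sub>L W o\<^sub>L B) = id_blinfun" "B + (B o\<^sub>L K o\<^sub>L W o\<^sub>L J o\<^sub>L W) = id_blinfun"
    and V: "V = W o\<^sub>L K o\<^sub>L W"
  defines "Q \<equiv> J - (J o\<^sub>L W o\<^sub>L B o\<^sub>L K o\<^sub>L W o\<^sub>L J)"
  shows "(X + V) o\<^sub>L Q = id_blinfun" "Q o\<^sub>L (X + V) = id_blinfun"
proof -
  have XJ: "X (J x) = x" and JX: "J (X x) = x" for x
    using X by (metis blinfun_apply_blinfun_compose blinfun_apply_id_blinfun)+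
  have B1: "B x + K (W (J (W (B x)))) = x" and B2: "B x + B (K (W (J (W x)))) = x" for x
    using arg_cong[OF B(1), of "\<lambda>A. blinfun_apply A x"]
      arg_cong[OF B(2), of "\<lambda>A. blinfun_apply A x"] by (simp_all add: blinfun.add_left)
  show "(X + V) o\<^sub>L Q = id_blinfun"
  proof (rule blinfun_eqI)
    fix x
    define y where "y = K (W (J x))"
    have "((X + V) o\<^sub>L Q) x = x - W (B y) + W y - W (K (W (J (W (B y)))))"
      unfolding Q_def V y_def
      by (simp add: XJ blinfun.add_left blinfun.diff_left blinfun.diff_right)
    also have "\<dots> = x - W (B y + K (W (J (W (B y))))) + W y"
      by (simp add: blinfun.add_right)
    finally show "((X + V) o\<^sub>L Q) x = id_blinfun x"
      by (simp add: B1)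
  qed
  show "Q o\<^sub>L (X + V) = id_blinfun"
  proof (rule blinfun_eqI)
    fix x
    define y where "y = K (W x)"
    have "(Q o\<^sub>L (X + V)) x = x + J (W y) - J (W (B y)) - J (W (B (K (W (J (W y))))))"
      unfolding Q_def V y_def
      by (simp add: JX blinfun.add_left blinfun.diff_left blinfun.add_right)
    also have "\<dots> = x + J (W y) - J (W (B y + B (K (W (J (W y))))))"
      by (simp add: blinfun.add_right)
    finally show "(Q o\<^sub>L (X + V)) x = id_blinfun x"
      by (simp add: B2)
  qed
qed

text \<open>The Weyl sequence for \<open>2 - 2 cos \<theta>\<close>: plane waves damped geometrically around a site far away
  from the origin, where the perturbation is negligible.\<close>

lemma interval_subset_spectrum:
  assumes q: "0 < q" "q < 1" and V: "V = weight q o\<^sub>L K o\<^sub>L weight q" and x: "x \<in> {0..4}"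
  shows "complex_of_real x \<in> spectrum (H0 + V)"
proof (rule ccontr)
  define z where "z = complex_of_real x"
  assume "complex_of_real x \<notin> spectrum (H0 + V)"
  then obtain R where R: "R o\<^sub>L (scalar_op z - (H0 + V)) = id_blinfun"
    unfolding spectrum_def is_resolvent_at_def z_def by blast
  have "R ((scalar_op z - (H0 + V)) y) = y" for y
    using R by (metis blinfun_apply_blinfun_compose blinfun_apply_id_blinfun)
  then have lower: "norm y \<le> norm R * norm ((scalar_op z - (H0 + V)) y)" for y
    using norm_blinfun[of R "(scalar_op z - (H0 + V)) y"] by simp
  define b where "b = norm (weight q o\<^sub>L K)"
  define \<theta> where "\<theta> = arccos (1 - x / 2)"
  have "cos \<theta> = 1 - x / 2" unfolding \<theta>_def using x by (intro cos_arccos) auto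
  then have z: "z = 2 - cis \<theta> - cis (- \<theta>)"
    by (simp add: z_def complex_eq_iff)
  have "((\<lambda>r. norm R * (2 * (1 / r - 1))) \<longlongrightarrow> 0) (at_left 1)"
    by (auto intro!: tendsto_eq_intros)
  then have "\<forall>\<^sub>F r in at_left 1. norm R * (2 * (1 / r - 1)) < 1 / 2"
    by (rule order_tendstoD) simp
  \<comment> \<open>This gives \<open>q \<le> r^2\<close>, so the weight supplies two factors
    \<open>r ^ \<bar>n\<bar>\<close>: one combines with the damping about the site \<open>M\<close>
    to at most \<open>r ^ M\<close>, the other keeps the sequence square summable.\<close>
  moreover have "\<forall>\<^sub>F r in at_left 1. sqrt q < r \<and> r < (1 :: real)"
    using q by (intro eventually_conj eventually_at_leftI[of "sqrt q"]) auto
  ultimately have "\<forall>\<^sub>F r in at_left 1. norm R * (2 * (1 / r - 1)) < 1 / 2 \<and> sqrt q < r \<and> r < 1"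
    by (rule eventually_conj)
  then obtain r where r: "norm R * (2 * (1 / r - 1)) < 1 / 2" "sqrt q < r" "r < 1"
    using eventually_happens by fastforce
  have "0 < sqrt q" using q by simp
  then have r0: "0 < r" using r by linarith
  have qr: "q \<le> r\<^sup>2"
    using power_mono[of "sqrt q" r 2] r q by simp
  \<comment> \<open>The damping \<open>r\<close> is fixed first to make the free error small; the
    site \<open>M\<close> is then moved out until the perturbation is small too.\<close>
  have "(\<lambda>M. norm R * (b * r ^ M)) \<longlonglongrightarrow> norm R * (b * 0)"
    using r r0 by (intro tendsto_intros LIMSEQ_power_zero) auto
  then have "\<forall>\<^sub>F M in sequentially. norm R * (b * r ^ M) < 1 / 2"
    by (intro order_tendstoD) auto
  then obtain M :: nat where M: "norm R * (b * r ^ M) < 1 / 2"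
    using eventually_happens by fastforce
  define g where "g = shift (- int M) (geo_vec (of_real r))"
  have g: "coord g n = of_real (r ^ nat \<bar>n - int M\<bar>)" for n
    using r r0 by (simp add: g_def coord_geo_vec)
  define f where "f n = cis (\<theta> * of_int n) * coord g n" for n
  have "(\<lambda>n. (cmod (f n))\<^sup>2) summable_on UNIV"
    using square_summable_coord[of g] by (simp add: f_def norm_mult)
  then obtain y where y: "coord y = f"
    by (metis mem_Collect_eq Abs_ell2_inverse)
  have ny: "norm y = norm g"
    by (simp add: norm_ell2_def y f_def norm_mult)
  have "coord y (int M) \<noteq> 0" by (simp add: y f_def g)
  then have "y \<noteq> 0" by auto
  define a where "a n = r ^ nat \<bar>n - int M\<bar>" for n
  \<comment> \<open>Neighbouring amplitudes differ by a factor \<open>r\<close> or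
    \<open>1 / r\<close>; the relative change is at most \<open>1 / r - 1\<close> in both
    cases.\<close>
  have step: "\<bar>a (n + s) - a n\<bar> \<le> (1 / r - 1) * a n" if "s = 1 \<or> s = -1" for n s
  proof -
    have "nat \<bar>n + s - int M\<bar> = Suc (nat \<bar>n - int M\<bar>) \<or>
        nat \<bar>n - int M\<bar> = Suc (nat \<bar>n + s - int M\<bar>)"
      using that by (elim disjE; hypsubst; arith)
    then consider "nat \<bar>n + s - int M\<bar> = Suc (nat \<bar>n - int M\<bar>)" |
      "nat \<bar>n - int M\<bar> = Suc (nat \<bar>n + s - int M\<bar>)"
      by blast
    then show ?thesis
    proof cases
      case 1
      have "a (n + s) - a n = - ((1 - r) * a n)"
        unfolding a_def 1 by (simp add: algebra_simps)
      moreover have "a n > 0" using r0 by (simp add: a_def)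
      ultimately have "\<bar>a (n + s) - a n\<bar> = (1 - r) * a n"
        using r(3) by (simp only: abs_minus_cancel) simp
      also have "\<dots> \<le> (1 / r - 1) * a n"
      proof (rule mult_right_mono)
        show "1 - r \<le> 1 / r - 1"
          using r0 zero_le_power2[of "1 - r"] by (simp add: field_simps power2_eq_square)
      qed (use \<open>a n > 0\<close> in simp)
      finally show ?thesis .
    next
      case 2
      have an: "a n = r * a (n + s)" unfolding a_def 2 by simp
      have "a (n + s) > 0" using r0 by (simp add: a_def)
      have "a (n + s) - a n = (1 - r) * a (n + s)" by (simp add: an algebra_simps)
      then have "\<bar>a (n + s) - a n\<bar> = (1 - r) * a (n + s)"
        using r(3) \<open>a (n + s) > 0\<close> by simp
      also have "\<dots> = (1 / r - 1) * a n"
        using r0 by (simp add: an field_simps)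
      finally show ?thesis by simp
    qed
  qed
  have "norm ((scalar_op z - H0) y) \<le> (2 * (1 / r - 1)) * norm g"
  proof (rule norm_le_of_coord_le)
    fix n
    \<comment> \<open>The undamped plane wave solves the eigenvalue equation at \<open>z\<close>, so
      only the differences of the amplitudes survive.\<close>
    have "coord ((scalar_op z - H0) y) n = cis (\<theta> * of_int n) *
        (cis \<theta> * of_real (a (n + 1) - a n) + cis (- \<theta>) * of_real (a (n - 1) - a n))"
    proof -
      have "f n = cis (\<theta> * of_int n) * of_real (a n)"
        by (simp add: f_def g a_def)
      moreover have "f (n + 1) = cis (\<theta> * of_int n) * cis \<theta> * of_real (a (n + 1))"
        by (simp add: f_def g a_def cis_mult distrib_left)
      moreover have "f (n - 1) = cis (\<theta> * of_int n) * cis (- \<theta>) * of_real (a (n - 1))"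
        by (simp add: f_def g a_def cis_mult right_diff_distrib)
      ultimately show ?thesis
        by (simp add: z blinfun.diff_left coord_H0 y algebra_simps)
    qed
    also have "cmod \<dots> \<le> \<bar>a (n + 1) - a n\<bar> + \<bar>a (n - 1) - a n\<bar>"
      using norm_triangle_ineq[of "cis \<theta> * of_real (a (n + 1) - a n)"
          "cis (- \<theta>) * of_real (a (n - 1) - a n)"]
      by (simp add: norm_mult del: of_real_diff)
    also have "\<dots> \<le> 2 * (1 / r - 1) * a n"
    proof -
      have "\<bar>a (n + 1) - a n\<bar> \<le> (1 / r - 1) * a n" "\<bar>a (n - 1) - a n\<bar> \<le> (1 / r - 1) * a n"
        using step[of 1 n] step[of "-1" n] by simp_all
      moreover have "2 * (1 / r - 1) * a n = (1 / r - 1) * a n + (1 / r - 1) * a n"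
        by (simp add: algebra_simps)
      ultimately show ?thesis by linarith
    qed
    also have "a n = cmod (coord g n)"
      using r0 by (simp add: g a_def norm_power)
    finally show "cmod (coord ((scalar_op z - H0) y) n) \<le> 2 * (1 / r - 1) * cmod (coord g n)" .
  qed (use r r0 in \<open>simp add: field_simps\<close>)
  moreover have "norm (V y) \<le> b * (r ^ M * norm g)"
  proof -
    have "norm (weight q y) \<le> r ^ M * norm (geo_vec (of_real r))"
    proof (rule norm_le_of_coord_le)
      fix n :: int
      have "M \<le> nat \<bar>n\<bar> + nat \<bar>n - int M\<bar>" by linarith
      then have "r ^ (nat \<bar>n\<bar> + nat \<bar>n - int M\<bar>) \<le> r ^ M"
        using r r0 by (intro power_decreasing) auto
      have "q ^ nat \<bar>n\<bar> \<le> r ^ nat \<bar>n\<bar> * r ^ nat \<bar>n\<bar>"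
        using power_mono[OF qr, of "nat \<bar>n\<bar>"] q by (simp add: power2_eq_square power_mult_distrib)
      then have "q ^ nat \<bar>n\<bar> * r ^ nat \<bar>n - int M\<bar> \<le>
          r ^ nat \<bar>n\<bar> * r ^ nat \<bar>n\<bar> * r ^ nat \<bar>n - int M\<bar>"
        using r0 by (intro mult_right_mono) auto
      also have "\<dots> = r ^ (nat \<bar>n\<bar> + nat \<bar>n - int M\<bar>) * r ^ nat \<bar>n\<bar>"
        by (simp add: power_add)
      also have "\<dots> \<le> r ^ M * r ^ nat \<bar>n\<bar>"
        using \<open>r ^ (nat \<bar>n\<bar> + nat \<bar>n - int M\<bar>) \<le> r ^ M\<close> r0 by (intro mult_right_mono) auto
      finally have "q ^ nat \<bar>n\<bar> * r ^ nat \<bar>n - int M\<bar> \<le> r ^ M * r ^ nat \<bar>n\<bar>" .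
      then show "cmod (coord (weight q y) n) \<le> r ^ M * cmod (coord (geo_vec (of_real r)) n)"
        using q r r0 by (simp add: coord_weight y f_def g coord_geo_vec norm_mult norm_power)
    qed (use r0 in simp)
    moreover have "norm (V y) \<le> b * norm (weight q y)"
      using norm_blinfun[of "weight q o\<^sub>L K" "weight q y"] by (simp add: V b_def)
    moreover have "norm (geo_vec (of_real r)) = norm g"
      by (simp add: g_def norm_shift)
    ultimately show ?thesis
      using mult_left_mono[of "norm (weight q y)" "r ^ M * norm g" b] by (simp add: b_def)
  qed
  ultimately have "norm ((scalar_op z - H0) y - V y) \<le> (2 * (1 / r - 1)) * norm g + b * (r ^ M * norm g)"
    by (intro order_trans[OF norm_triangle_ineq4] add_mono)
  moreover have "(scalar_op z - (H0 + V)) y = (scalar_op z - H0) y - V y"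
    by (simp add: blinfun.diff_left blinfun.add_left)
  ultimately have "norm ((scalar_op z - (H0 + V)) y) \<le> (2 * (1 / r - 1) + b * r ^ M) * norm g"
    by (simp only: distrib_right mult.assoc)
  then have "norm y \<le> norm R * ((2 * (1 / r - 1) + b * r ^ M) * norm g)"
    by (intro order_trans[OF lower[of y]] mult_left_mono norm_ge_zero)
  also have "\<dots> = (norm R * (2 * (1 / r - 1)) + norm R * (b * r ^ M)) * norm g"
    by (simp add: algebra_simps)
  also have "\<dots> < 1 * norm g"
  proof (rule mult_strict_right_mono)
    show "norm R * (2 * (1 / r - 1)) + norm R * (b * r ^ M) < 1" using r(1) M by linarith
  qed (use \<open>y \<noteq> 0\<close> ny in auto)
  finally show False by (simp add: ny)
qed

lemma not_isolated_in_spectrum: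
  assumes "of_real ` {0..4} \<subseteq> S" "x \<in> {0..4}"
  shows "\<not> complex_of_real x isolated_in S"
proof
  assume "complex_of_real x isolated_in S"
  then obtain T where T: "open T" "T \<inter> S = {of_real x}"
    unfolding isolated_in_def by blast
  have "open (complex_of_real -` T)"
    by (rule open_vimage[OF T(1)]) (rule continuous_on_of_real_id)
  moreover have "x \<in> complex_of_real -` T" using T by auto
  ultimately obtain e where e: "e > 0" "ball x e \<subseteq> complex_of_real -` T"
    by (rule openE)
  \<comment> \<open>A nearby point of the interval, to the right of \<open>x\<close> except at the
    endpoint 4, where the step to the left is capped at 1.\<close>
  define y where "y = (if x < 4 then min 4 (x + e / 2) else x - min 1 (e / 2))"
  have "y \<in> ball x e" "y \<in> {0..4}" "y \<noteq> x"
    using e(1) assms(2) unfolding y_def mem_ball dist_real_def by (simp; linarith)+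
  then have "of_real y \<in> T \<inter> S" using e(2) assms(1) by (auto simp: subset_iff)
  then show False using \<open>y \<noteq> x\<close> unfolding T(2) by simp
qed

section \<open>The weighted resolvent of the perturbed operator\<close>

text \<open>The decay of \<open>V\<close> at rate \<open>q^2\<close> is shared equally: one factor
  goes into the two outer weights, the other stays in the kernel and keeps it compact.\<close>

lemma matrix_factorization:
  assumes V: "complex_linear V" and q: "0 < q" "q < 1"
    and bound: "\<And>n m. cmod (matrix_entry V n m) \<le> C * (q ^ (nat \<bar>n\<bar> + nat \<bar>m\<bar>))\<^sup>2"
  obtains k where "decaying q C k" "V = weight q o\<^sub>L kernel_op k o\<^sub>L weight q"
proof -
  define k where "k n m = matrix_entry V n m / of_real (q ^ (nat \<bar>n\<bar> + nat \<bar>m\<bar>))" for n m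
  have "cmod (k n m) \<le> C * q ^ (nat \<bar>n\<bar> + nat \<bar>m\<bar>)" for n m
    using bound[of n m] q by (simp add: k_def norm_divide norm_power pos_divide_le_eq power2_eq_square
        mult.assoc)
  then have dec: "decaying q C k" by (simp add: decaying_def)
  have q': "0 \<le> q" "q < 1" "q \<le> 1" using q by auto
  have "V = weight q o\<^sub>L kernel_op k o\<^sub>L weight q"
  proof (rule eq_by_matrix_entries[OF V])
    show "matrix_entry V n m = matrix_entry (weight q o\<^sub>L kernel_op k o\<^sub>L weight q) n m" for n m
      unfolding matrix_entry_weight_sandwich[OF q'(1,3) complex_linear_kernel_op[OF q'(1,2) dec]]
        matrix_entry_kernel_op[OF q'(1,2) dec] using q by (simp add: k_def)
  qed (intro complex_linear_intros complex_linear_weight complex_linear_kernel_op[OF q'(1,2) dec] q')+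
  with dec show thesis by (rule that)
qed

context weights
begin

text \<open>Between two weights, each free inverse in the Woodbury formula becomes
  \<open>weighted_free w / (1 - w^2)\<close>. The right-hand side thus continues past the unit
  circle, although \<open>R\<close> itself exists only inside the disc.\<close>

lemma resolvent_formula:
  assumes V: "V = weight q o\<^sub>L K o\<^sub>L weight q" and K: "complex_linear K"
    and w: "w \<noteq> 0" "cmod w < 1" and d: "d \<noteq> 0"
    and G: "(scalar_op (1 - w\<^sup>2) + (K o\<^sub>L weighted_free w)) o\<^sub>L G = scalar_op d"
      "G o\<^sub>L (scalar_op (1 - w\<^sup>2) + (K o\<^sub>L weighted_free w)) = scalar_op d" "complex_linear G"
  obtains R where "is_resolvent_at (H0 + V) (spectral_param w) R"
    "weight q o\<^sub>L R o\<^sub>L weight q =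
      (scalar_op (1 / ((1 - w\<^sup>2) * d)) o\<^sub>L (weighted_free w o\<^sub>L (G o\<^sub>L (K o\<^sub>L weighted_free w)))) -
      (scalar_op (1 / (1 - w\<^sup>2)) o\<^sub>L weighted_free w)"
proof -
  obtain J where J: "complex_linear J"
    "(H0 - scalar_op (spectral_param w)) o\<^sub>L J = id_blinfun"
    "J o\<^sub>L (H0 - scalar_op (spectral_param w)) = id_blinfun"
    "\<And>n m. (1 - w\<^sup>2) * matrix_entry J n m = w ^ Suc (nat \<bar>n - m\<bar>)"
    using free_resolvent[OF w] by blast
  define e where "e = 1 - w\<^sup>2"
  \<comment> \<open>The diagonal entry shows that \<open>1 - w^2\<close> cannot vanish, since
    \<open>w\<close> is nonzero.\<close>
  have "e * matrix_entry J 0 0 = w" using J(4)[of 0 0] by (simp add: e_def)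
  then have e: "e \<noteq> 0" using w by auto
  define W where "W = weight q"
  define S where "S = weighted_free w"
  have S: "e *\<^sub>C W (J (W x)) = S x" for x
    using arg_cong[OF weighted_free_resolvent[OF w J(1,4)], of "\<lambda>A. blinfun_apply A x"]
    by (simp add: S_def W_def e_def)
  have T: "W (J (W x)) = (1 / e) *\<^sub>C S x" for x
    using e by (simp flip: S)
  have linW: "complex_linear W"
    unfolding W_def using q by (intro complex_linear_weight) auto
  have linS: "complex_linear S"
    unfolding S_def using w \<rho> by (intro op_holomorphic_complex_linear[OF op_holomorphic_weighted_free]) auto
  note lin = complex_linearD[OF linW] complex_linearD[OF linS] complex_linearD[OF K]
    complex_linearD[OF J(1)] complex_linearD[OF G(3)]
  have G1: "e *\<^sub>C G x + K (S (G x)) = d *\<^sub>C x" and G2: "e *\<^sub>C G x + G (K (S x)) = d *\<^sub>C x" for x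
    using arg_cong[OF G(1), of "\<lambda>A. blinfun_apply A x"]
      arg_cong[OF G(2), of "\<lambda>A. blinfun_apply A x"]
    by (simp_all add: blinfun.add_left blinfun.add_right lin S_def e_def)
  \<comment> \<open>As \<open>1 + K W J W\<close> is \<open>1 / e\<close> times the operator
    inverted by \<open>G / d\<close>, its inverse is \<open>e / d\<close> times
    \<open>G\<close>.\<close>
  define B where "B = scalar_op (e / d) o\<^sub>L G"
  have B: "B + (K o\<^sub>L W o\<^sub>L J o\<^sub>L W o\<^sub>L B) = id_blinfun" "B + (B o\<^sub>L K o\<^sub>L W o\<^sub>L J o\<^sub>L W) = id_blinfun"
  proof -
    have "(B + (K o\<^sub>L W o\<^sub>L J o\<^sub>L W o\<^sub>L B)) x = id_blinfun x"
      "(B + (B o\<^sub>L K o\<^sub>L W o\<^sub>L J o\<^sub>L W)) x = id_blinfun x" for x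
    proof -
    have "(B + (K o\<^sub>L W o\<^sub>L J o\<^sub>L W o\<^sub>L B)) x = (1 / d) *\<^sub>C (e *\<^sub>C G x + K (S (G x)))"
      using e by (simp add: B_def blinfun.add_left T lin ell2.scale_right_distrib)
    then show "(B + (K o\<^sub>L W o\<^sub>L J o\<^sub>L W o\<^sub>L B)) x = id_blinfun x"
      using d by (simp add: G1)
    have "(B + (B o\<^sub>L K o\<^sub>L W o\<^sub>L J o\<^sub>L W)) x = (1 / d) *\<^sub>C (e *\<^sub>C G x + G (K (S x)))"
      using e by (simp add: B_def blinfun.add_left T lin ell2.scale_right_distrib)
    then show "(B + (B o\<^sub>L K o\<^sub>L W o\<^sub>L J o\<^sub>L W)) x = id_blinfun x"
      using d by (simp add: G2)
    qed
    then show "B + (K o\<^sub>L W o\<^sub>L J o\<^sub>L W o\<^sub>L B) = id_blinfun"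
      "B + (B o\<^sub>L K o\<^sub>L W o\<^sub>L J o\<^sub>L W) = id_blinfun"
      by (auto intro: blinfun_eqI)
  qed
  define Q where "Q = J - (J o\<^sub>L W o\<^sub>L B o\<^sub>L K o\<^sub>L W o\<^sub>L J)"
  have V': "V = W o\<^sub>L K o\<^sub>L W" by (simp add: V W_def)
  have neg: "(- A) o\<^sub>L (- C) = A o\<^sub>L C" for A C :: "ell2 \<Rightarrow>\<^sub>L ell2"
    by (rule blinfun_eqI) (simp add: blinfun.minus_left blinfun.minus_right)
  have Y: "scalar_op (spectral_param w) - (H0 + V) = - (H0 - scalar_op (spectral_param w) + V)"
    by simp
  \<comment> \<open>\<open>Q\<close> inverts \<open>H0 + V - z\<close>, hence the minus sign for the
    inverse of \<open>z - (H0 + V)\<close>.\<close>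
  have "is_resolvent_at (H0 + V) (spectral_param w) (- Q)"
    unfolding is_resolvent_at_def Y neg Q_def
    using resolvent_identity[OF J(2,3) B V'] by blast
  moreover have "weight q o\<^sub>L - Q o\<^sub>L weight q =
      (scalar_op (1 / ((1 - w\<^sup>2) * d)) o\<^sub>L (S o\<^sub>L (G o\<^sub>L (K o\<^sub>L S)))) - (scalar_op (1 / (1 - w\<^sup>2)) o\<^sub>L S)"
    unfolding e_def[symmetric] W_def[symmetric]
  proof (rule blinfun_eqI)
    fix x
    have "(W o\<^sub>L - Q o\<^sub>L W) x = W (J (W (B (K (W (J (W x))))))) - W (J (W x))"
      by (simp add: Q_def blinfun.minus_left blinfun.diff_left blinfun.diff_right
          blinfun.minus_right)
    also have "\<dots> = (1 / (e * d)) *\<^sub>C S (G (K (S x))) - (1 / e) *\<^sub>C S x"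
      unfolding T using e by (simp add: B_def lin)
    finally show "(W o\<^sub>L - Q o\<^sub>L W) x =
        ((scalar_op (1 / (e * d)) o\<^sub>L (S o\<^sub>L (G o\<^sub>L (K o\<^sub>L S)))) - (scalar_op (1 / e) o\<^sub>L S)) x"
      by (simp add: blinfun.diff_left)
  qed
  ultimately show thesis
    unfolding S_def by (rule that)
qed

end

text \<open>Including the unit circle provides limits on the real axis from both half-planes. The
  bound \<open>c\<close> keeps away from \<open>w = 0\<close>, where \<open>spectral_param\<close>
  is discontinuous.\<close>

lemma compact_spectral_param_strip:
  fixes X :: "real set"
  assumes "closed X" "c > 0"
  shows "compact {w. c \<le> cmod w \<and> cmod w \<le> 1 \<and>
    Re (spectral_param w) \<in> X \<and> \<bar>Im (spectral_param w)\<bar> \<le> s}"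
proof -
  define A where "A = cball (0 :: complex) 1 - ball 0 c"
  define Y where "Y = {z. Re z \<in> X \<and> \<bar>Im z\<bar> \<le> s}"
  have A: "compact A" unfolding A_def by (intro compact_diff compact_cball open_ball)
  have "continuous_on A spectral_param"
    unfolding spectral_param_def[abs_def] A_def
    by (intro continuous_intros) (use assms in auto)
  moreover have "closed Y"
  proof -
    have "Y = (Re -` X) \<inter> {z. \<bar>Im z\<bar> \<le> s}" by (auto simp: Y_def)
    moreover have "closed (Re -` X)"
      by (rule closed_vimage[OF assms(1)]) (intro continuous_intros)
    moreover have "closed {z. \<bar>Im z\<bar> \<le> s}"
      by (intro closed_Collect_le continuous_intros)
    ultimately show ?thesis by auto
  qed
  ultimately have "closed (A \<inter> spectral_param -` Y)"
    using continuous_closed_preimage compact_imp_closed[OF A] by blast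
  then have "compact (A \<inter> (A \<inter> spectral_param -` Y))"
    by (rule compact_Int_closed[OF A])
  moreover have "A \<inter> (A \<inter> spectral_param -` Y) = {w. c \<le> cmod w \<and> cmod w \<le> 1 \<and>
    Re (spectral_param w) \<in> X \<and> \<bar>Im (spectral_param w)\<bar> \<le> s}"
    by (auto simp: A_def Y_def)
  ultimately show ?thesis by simp
qed

theorem theorem2p5:
  fixes V :: "ell2 \<Rightarrow>\<^sub>L ell2" and \<delta> :: real
  assumes "complex_linear V"
    and "\<delta> > 0"
    and "bdd_above (range (\<lambda>(n, m).
           exp (\<delta> * (of_int \<bar>n\<bar> + of_int \<bar>m\<bar>)) * cmod (matrix_entry V n m)))"
  shows "(\<forall>x\<in>{0..4::real}. \<not> complex_of_real x islimpt disc_spectrum (H0 + V)) \<and>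
    finite (disc_spectrum (H0 + V)) \<and>
    (\<exists>D' :: real set. finite D' \<and> D' \<subseteq> {0<..<4} \<and>
      (\<forall>\<Delta>0 :: real set.
        is_interval \<Delta>0 \<and> compact (closure \<Delta>0) \<and> closure \<Delta>0 \<subseteq> {0<..<4} - D' \<longrightarrow>
        (\<exists>\<delta>0>0.
          complex_rect \<Delta>0 {-\<delta>0<..<0} \<inter> spectrum (H0 + V) = {} \<and>
          complex_rect \<Delta>0 {0<..<\<delta>0} \<inter> spectrum (H0 + V) = {} \<and>
          (\<forall>\<phi>\<in>weighted_ell2 \<delta>. \<forall>\<psi>\<in>weighted_ell2 \<delta>.
            bdd_above ((\<lambda>z. cmod (cinner \<phi> (resolvent (H0 + V) z \<psi>)))
              ` complex_rect \<Delta>0 {-\<delta>0<..<0}) \<and>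
            bdd_above ((\<lambda>z. cmod (cinner \<phi> (resolvent (H0 + V) z \<psi>)))
              ` complex_rect \<Delta>0 {0<..<\<delta>0})))))"
proof -
  define q where "q = exp (- \<delta> / 2)"
  have q: "0 < q" "q < 1" using assms(2) by (auto simp: q_def)
  have q': "0 \<le> q" "q < 1" "q \<le> 1" using q by auto
  have q2: "exp (\<delta> * (of_int \<bar>n\<bar> + of_int \<bar>m\<bar>)) * (q ^ (nat \<bar>n\<bar> + nat \<bar>m\<bar>))\<^sup>2 = 1" for n m :: int
    by (simp add: q_def flip: exp_of_nat_mult power_mult exp_add)
  obtain C where C: "\<And>n m. exp (\<delta> * (of_int \<bar>n\<bar> + of_int \<bar>m\<bar>)) * cmod (matrix_entry V n m) \<le> C"
    using assms(3) unfolding bdd_above_def by fastforce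
  have "cmod (matrix_entry V n m) \<le> C * (q ^ (nat \<bar>n\<bar> + nat \<bar>m\<bar>))\<^sup>2" for n m
  proof -
    have "cmod (matrix_entry V n m) =
        (exp (\<delta> * (of_int \<bar>n\<bar> + of_int \<bar>m\<bar>)) * cmod (matrix_entry V n m)) * (q ^ (nat \<bar>n\<bar> + nat \<bar>m\<bar>))\<^sup>2"
      using q2[of n m] by (metis mult.assoc mult.commute mult_1)
    also have "\<dots> \<le> C * (q ^ (nat \<bar>n\<bar> + nat \<bar>m\<bar>))\<^sup>2"
      by (rule mult_right_mono[OF C]) simp
    finally show ?thesis .
  qed
  then obtain k where k: "decaying q C k" and V: "V = weight q o\<^sub>L kernel_op k o\<^sub>L weight q"
    using matrix_factorization[OF assms(1) q] by blast
  define K where "K = kernel_op k"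
  have linK: "complex_linear K"
    unfolding K_def by (rule complex_linear_kernel_op[OF q'(1,2) k])
  \<comment> \<open>The midpoint of 1 and \<open>1 / q\<close>, which gives both
    \<open>1 < \<rho>\<close> and \<open>q * \<rho> < 1\<close>.\<close>
  define \<rho> where "\<rho> = (1 + 1 / q) / 2"
  interpret weights q \<rho>
    by unfold_locales (use q in \<open>auto simp: \<rho>_def field_simps\<close>)
  obtain d G where d: "d holomorphic_on U" "d 0 \<noteq> 0" and G: "G op_holomorphic_on U"
    and inv: "\<And>w. w \<in> U \<Longrightarrow> (scalar_op (1 - w\<^sup>2) + (K o\<^sub>L weighted_free w)) o\<^sub>L G w = scalar_op (d w)"
      "\<And>w. w \<in> U \<Longrightarrow> G w o\<^sub>L (scalar_op (1 - w\<^sup>2) + (K o\<^sub>L weighted_free w)) = scalar_op (d w)"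
    using invertible_off_zeros_weighted_free[OF k] unfolding invertible_off_zeros_def K_def by blast
  have UI: "w \<in> U" if "cmod w \<le> 1" for w
    using that \<rho>(1) by simp
  define F where "F w =
    (scalar_op (1 / ((1 - w\<^sup>2) * d w)) o\<^sub>L (weighted_free w o\<^sub>L (G w o\<^sub>L (K o\<^sub>L weighted_free w)))) -
      (scalar_op (1 / (1 - w\<^sup>2)) o\<^sub>L weighted_free w)" for w
  have res: "\<exists>R. is_resolvent_at (H0 + V) (spectral_param w) R \<and> weight q o\<^sub>L R o\<^sub>L weight q = F w"
    if "w \<noteq> 0" "cmod w < 1" "d w \<noteq> 0" for w
    using resolvent_formula[OF V[folded K_def] linK that inv op_holomorphic_complex_linear[OF G]]
      UI[of w] that unfolding F_def by (metis less_imp_le)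
  \<comment> \<open>The closed unit disc is a compact subset of \<open>U\<close> and
    \<open>d\<close> is not identically zero, so these zeros are finite in number.\<close>
  define Z where "Z = {w \<in> cball 0 1. d w = 0}"
  have fin: "finite Z"
  proof (cases "d constant_on U")
    case True
    then have "d w = d 0" if "w \<in> U" for w
      using that UI[of 0] unfolding constant_on_def by auto
    with d UI have "Z = {}" by (auto simp: Z_def)
    then show ?thesis by simp
  next
    case False
    then show ?thesis
      unfolding Z_def using UI
      by (intro holomorphic_compact_finite_zeros[OF d(1)]) auto
  qed
  have ess: "complex_of_real ` {0..4} \<subseteq> spectrum (H0 + V)"
    using interval_subset_spectrum[OF q V] by blast
  \<comment> \<open>An isolated spectral point lies off [0,4] and hence comes from some
    \<open>w\<close> inside the disc; if \<open>d w\<close> were nonzero, the resolvent would exist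
    there.\<close>
  have "disc_spectrum (H0 + V) \<subseteq> spectral_param ` Z"
  proof
    fix z assume "z \<in> disc_spectrum (H0 + V)"
    then have z: "z isolated_in spectrum (H0 + V)" by (simp add: disc_spectrum_def)
    then have "z \<notin> of_real ` {0..4}" using not_isolated_in_spectrum[OF ess] by blast
    then obtain w where w: "w \<noteq> 0" "cmod w < 1" "spectral_param w = z"
      by (rule spectral_param_surj)
    have "z \<in> spectrum (H0 + V)" using z by (simp add: isolated_in_def)
    then have "d w = 0" using res[OF w(1,2)] w(3) by (auto simp: spectrum_def)
    with w show "z \<in> spectral_param ` Z" by (auto simp: Z_def)
  qed
  then have fin_disc: "finite (disc_spectrum (H0 + V))"
    using fin finite_subset by blast
  \<comment> \<open>The points of (0,4) over which the continued weighted resolvent may blow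
    up.\<close>
  define D' where "D' = {x \<in> {0<..<4}. complex_of_real x \<in> spectral_param ` Z}"
  have "D' \<subseteq> Re ` spectral_param ` Z"
    unfolding D'_def by (auto simp: image_iff) (metis Re_complex_of_real)
  then have fin_D': "finite D'"
    using fin finite_subset by blast
  have main: "\<exists>s>0. \<exists>B. \<forall>z. Re z \<in> X \<and> Im z \<noteq> 0 \<and> \<bar>Im z\<bar> < s \<longrightarrow>
      (\<exists>R. is_resolvent_at (H0 + V) z R \<and> norm (weight q o\<^sub>L R o\<^sub>L weight q) \<le> B)"
    if X: "closure X \<subseteq> {0<..<4} - D'" for X
  proof -
    \<comment> \<open>Heights of the nonreal values over zeros of \<open>d\<close>. Half their
      minimum gives a strip whose nonreal points avoid all of them; the inserted 1 makes the set
      nonempty and yields \<open>s < 1\<close>.\<close>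
    define I where "I = insert 1 ((\<lambda>w. \<bar>Im (spectral_param w)\<bar>) ` Z - {0})"
    have I: "finite I" "I \<noteq> {}" using fin by (auto simp: I_def)
    define s where "s = Min I / 2"
    have "Min I > 0" using I by (auto simp: I_def Min_gr_iff)
    moreover have "Min I \<le> 1" using I by (intro Min_le) (auto simp: I_def)
    ultimately have s: "0 < s" "s < 1" by (auto simp: s_def)
    \<comment> \<open>All \<open>w\<close> needed below satisfy \<open>1 / 8 \<le> cmod w\<close>:
      from \<open>cmod z \<le> 5\<close> and \<open>1 / w = 2 - w - z\<close> follows
      \<open>1 / cmod w \<le> 2 + 1 + 5\<close>.\<close>
    define A where "A = {w. 1 / 8 \<le> cmod w \<and> cmod w \<le> 1 \<and>
      Re (spectral_param w) \<in> closure X \<and> \<bar>Im (spectral_param w)\<bar> \<le> s}"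
    have A: "compact A"
      unfolding A_def by (rule compact_spectral_param_strip) auto
    have AU: "w \<in> U" if "w \<in> A" for w
      using that by (intro UI) (simp add: A_def)
    have dA: "d w \<noteq> 0" if w: "w \<in> A" for w
    proof
      assume "d w = 0"
      then have "w \<in> Z" using w by (simp add: Z_def A_def)
      have "Im (spectral_param w) = 0"
      proof (rule ccontr)
        assume "Im (spectral_param w) \<noteq> 0"
        with \<open>w \<in> Z\<close> have "\<bar>Im (spectral_param w)\<bar> \<in> I" by (auto simp: I_def)
        then have "Min I \<le> \<bar>Im (spectral_param w)\<bar>" using I by (intro Min_le)
        then show False using w s by (simp add: A_def s_def)
      qed
      then have "spectral_param w = of_real (Re (spectral_param w))"
        by (simp add: complex_eq_iff)
      moreover have "Re (spectral_param w) \<in> {0<..<4} - D'"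
        using w X by (auto simp: A_def)
      ultimately show False
        using \<open>w \<in> Z\<close> unfolding D'_def by (metis (mono_tags, lifting) DiffE image_eqI mem_Collect_eq)
    qed
    \<comment> \<open>The points 1 and -1 lie over 0 and 4, which are outside the closure of
      \<open>X\<close>.\<close>
    have eA: "1 - w\<^sup>2 \<noteq> 0" if w: "w \<in> A" for w
    proof
      assume "1 - w\<^sup>2 = 0"
      then have "w = 1 \<or> w = - 1" by (metis eq_iff_diff_eq_0 power2_eq_1_iff)
      then have "Re (spectral_param w) \<notin> {0<..<4}" by (auto simp: spectral_param_def)
      then show False using w X by (auto simp: A_def)
    qed
    have cont_op: "continuous_on A H" if "H op_holomorphic_on U" for H
      using op_holomorphic_continuous[OF that] by (rule continuous_on_subset) (use AU in auto)
    have cont_d: "continuous_on A d"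
      using holomorphic_on_imp_continuous_on[OF d(1)] by (rule continuous_on_subset) (use AU in auto)
    have cont_scalar: "continuous_on A (\<lambda>w. scalar_op (f w))" if "continuous_on A f" for f
      by (rule bounded_linear.continuous_on[OF bounded_linear_scalar_op that])
    have cont_comp: "continuous_on A (\<lambda>w. L w o\<^sub>L M w)"
      if "continuous_on A L" "continuous_on A M" for L M :: "complex \<Rightarrow> ell2 \<Rightarrow>\<^sub>L ell2"
      by (rule bounded_bilinear.continuous_on[OF bounded_bilinear_blinfun_compose that])
    \<comment> \<open>Both denominators are nonzero on \<open>A\<close>, including its part on the
      unit circle, so compactness bounds the weighted resolvent uniformly up to the real
      axis.\<close>
    have "continuous_on A F"
      unfolding F_def[abs_def]
      by (intro continuous_on_diff cont_comp cont_scalar cont_op op_holomorphic_weighted_free G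
          continuous_intros cont_d ballI) (use dA eA in auto)
    then have "bounded (F ` A)"
      using A compact_continuous_image compact_imp_bounded by blast
    then obtain B where B: "\<And>w. w \<in> A \<Longrightarrow> norm (F w) \<le> B"
      unfolding bounded_iff by blast
    have "\<exists>R. is_resolvent_at (H0 + V) z R \<and> norm (weight q o\<^sub>L R o\<^sub>L weight q) \<le> B"
      if z: "Re z \<in> X" "Im z \<noteq> 0" "\<bar>Im z\<bar> < s" for z
    proof -
      have "z \<notin> of_real ` {0..4}" using z(2) by auto
      then obtain w where w: "w \<noteq> 0" "cmod w < 1" "spectral_param w = z"
        by (rule spectral_param_surj)
      have Re: "Re z \<in> closure X" using z(1) closure_subset by blast
      then have "\<bar>Re z\<bar> \<le> 4" using X by force
      then have "cmod z \<le> 5" using cmod_le[of z] z(3) s by linarith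
      have "1 / w = 2 - w - z" using w(3) by (auto simp: spectral_param_def)
      then have "1 / cmod w = cmod (2 - w - z)" by (metis norm_divide norm_one)
      also have "\<dots> \<le> cmod 2 + cmod w + cmod z"
        by (meson norm_triangle_ineq4 add_mono_thms_linordered_semiring(3) order_trans)
      also have "\<dots> \<le> 8" using w(2) \<open>cmod z \<le> 5\<close> by simp
      finally have "1 / 8 \<le> cmod w" using w(1) by (simp add: field_simps)
      then have "w \<in> A" using w Re z by (simp add: A_def)
      then show ?thesis using res[OF w(1,2) dA] B w(3) by metis
    qed
    then show ?thesis using s(1) by blast
  qed
  have "\<exists>s>0. complex_rect X {-s<..<0} \<inter> spectrum (H0 + V) = {} \<and>
      complex_rect X {0<..<s} \<inter> spectrum (H0 + V) = {} \<and>
      (\<forall>\<phi>\<in>weighted_ell2 \<delta>. \<forall>\<psi>\<in>weighted_ell2 \<delta>.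
        bdd_above ((\<lambda>z. cmod (cinner \<phi> (resolvent (H0 + V) z \<psi>))) ` complex_rect X {-s<..<0}) \<and>
        bdd_above ((\<lambda>z. cmod (cinner \<phi> (resolvent (H0 + V) z \<psi>))) ` complex_rect X {0<..<s}))"
    if X: "closure X \<subseteq> {0<..<4} - D'" for X
  proof -
    obtain s B where "s > 0" and sB: "\<And>z. Re z \<in> X \<Longrightarrow> Im z \<noteq> 0 \<Longrightarrow> \<bar>Im z\<bar> < s \<Longrightarrow>
        \<exists>R. is_resolvent_at (H0 + V) z R \<and> norm (weight q o\<^sub>L R o\<^sub>L weight q) \<le> B"
      using main[OF X] by blast
    define Y where "Y = complex_rect X {-s<..<0} \<union> complex_rect X {0<..<s}"
    have Y: "\<exists>R. is_resolvent_at (H0 + V) z R \<and> norm (weight q o\<^sub>L R o\<^sub>L weight q) \<le> B"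
      if "z \<in> Y" for z
      using that by (intro sB) (auto simp: Y_def complex_rect_def)
    then have disj: "Y \<inter> spectrum (H0 + V) = {}" by (auto simp: spectrum_def)
    have bdd: "bdd_above ((\<lambda>z. cmod (cinner \<phi> (resolvent (H0 + V) z \<psi>))) ` Y)"
      if \<phi>: "\<phi> \<in> weighted_ell2 \<delta>" and \<psi>: "\<psi> \<in> weighted_ell2 \<delta>" for \<phi> \<psi>
    proof -
      obtain f g where f: "\<phi> = weight q f" and g: "\<psi> = weight q g"
        using weighted_ell2_weight[OF \<phi> assms(2)] weighted_ell2_weight[OF \<psi> assms(2)]
        unfolding q_def by metis
      have "cmod (cinner \<phi> (resolvent (H0 + V) z \<psi>)) \<le> norm f * (B * norm g)" if z: "z \<in> Y" for z
      proof -
        obtain R where R: "is_resolvent_at (H0 + V) z R" "norm (weight q o\<^sub>L R o\<^sub>L weight q) \<le> B"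
          using Y[OF z] by blast
        \<comment> \<open>The weights of the two vectors move onto the resolvent, leaving the
          uniformly bounded operator between fixed vectors.\<close>
        have "cinner \<phi> (resolvent (H0 + V) z \<psi>) = cinner f ((weight q o\<^sub>L R o\<^sub>L weight q) g)"
          unfolding resolvent_eqI[OF R(1)] f g using q' by (simp add: cinner_weight)
        also have "cmod \<dots> \<le> norm f * norm ((weight q o\<^sub>L R o\<^sub>L weight q) g)"
          by (rule norm_cinner_le)
        also have "\<dots> \<le> norm f * (B * norm g)"
          by (intro mult_left_mono order_trans[OF norm_blinfun] mult_right_mono R(2)) auto
        finally show ?thesis .
      qed
      then show ?thesis by (intro bdd_aboveI2)
    qed
    have sub: "complex_rect X {-s<..<0} \<subseteq> Y" "complex_rect X {0<..<s} \<subseteq> Y"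
      by (auto simp: Y_def)
    show ?thesis
    proof (intro exI[of _ s] conjI ballI \<open>s > 0\<close>)
      fix \<phi> \<psi> assume "\<phi> \<in> weighted_ell2 \<delta>" "\<psi> \<in> weighted_ell2 \<delta>"
      note b = bdd[OF this]
      show "bdd_above ((\<lambda>z. cmod (cinner \<phi> (resolvent (H0 + V) z \<psi>))) ` complex_rect X {-s<..<0})"
        "bdd_above ((\<lambda>z. cmod (cinner \<phi> (resolvent (H0 + V) z \<psi>))) ` complex_rect X {0<..<s})"
        by (rule bdd_above_mono[OF b image_mono[OF sub(1)]],
          rule bdd_above_mono[OF b image_mono[OF sub(2)]])
    qed (use disj sub in blast)+
  qed
  note bounds = this
  show ?thesis
  proof (intro conjI ballI exI[of _ D'] allI impI)
    show "\<not> complex_of_real x islimpt disc_spectrum (H0 + V)" for x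
      using islimpt_finite[OF fin_disc] .
    show "D' \<subseteq> {0<..<4}" by (auto simp: D'_def)
  qed (use bounds in \<open>simp_all add: fin_disc fin_D'\<close>)
qed

end
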